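(* Let $[X,\mathcal B,m,\nu]$ be a reversible random walk space, $p>1$, and for each $x$ let $A_x,B_x\subset\mathrm{supp}(m_x)$ be non-null measurable sets with $A_x\cup B_x=\mathrm{supp}(m_x)$ (as in the context). Assume either (a) $\nu(X)<\infty$, or (b) $\nu(X)=+\infty$ and $p\ge2$. Then $$\partial_{L^2(X,\nu)}\big(\mathcal F_{A,1,m}+\mathcal F_{B,p,m}\big)=\partial_{L^2(X,\nu)}\mathcal F_{A,1,m}+\partial_{L^2(X,\nu)}\mathcal F_{B,p,m}=-\Delta_{1,A}^m-\Delta_{p,B}^m.$$ Furthermore, this operator is completely accretive and has dense domain in $L^2(X,\nu)$.
   Context: A random walk space $[X,\mathcal B,m,\nu]$: measurable space with countably generated $\sigma$-algebra, probability measures $m_x$ with $x\mapsto m_x(B)$ measurable, $\sigma$-finite invariant $\nu$ ($\nu(A)=\int m_x(A)\,d\nu(x)$); reversible: $dm_x(y)d\nu(x)=dm_y(x)d\nu(y)$. $\nu\otimes m_x$ is the measure $dm_x(y)d\nu(x)$ on $X\times X$; $\nabla u(x,y)=u(y)-u(x)$. The sets $\{(x,y):y\in A_x\}$, $\{(x,y):y\in B_x\}$ are measurable; $K_A(x,y)=\frac12(\chi_{A_x}(y)+\chi_{A_y}(x))$, $K_B(x,y)=\frac12(\chi_{B_x}(y)+\chi_{B_y}(x))$. On $L^2(X,\nu)$: $\mathcal F_{A,1,m}(u)=\frac12\int|\nabla u|K_A\,d(\nu\otimes m_x)$, $\mathcal F_{B,p,m}(u)=\frac1{2p}\int|\nabla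 u|^pK_B\,d(\nu\otimes m_x)$, each $+\infty$ if infinite. $\partial$ is the convex subdifferential; sum of operators is $\{(u,v_1+v_2):(u,v_i)\in A_i\}$. $(u,v)\in\Delta_{1,A}^m$ iff $(u,-v)\in\partial_{L^2(X,\nu)}\mathcal F_{A,1,m}(u)$. $(u,v)\in\Delta_{p,B}^m$ iff $u,v\in L^2(X,\nu)$, $\int K_B|\nabla u|^p\,d(\nu\otimes m_x)<\infty$ and $v(x)=\int_XK_B(x,y)|\nabla u(x,y)|^{p-2}\nabla u(x,y)\,dm_x(y)$. Complete accretivity of $A\subset L^2\times L^2$: for all $\lambda>0$, $(u_1,v_1),(u_2,v_2)\in A$, $\int j(u_1-u_2)\,d\nu\le\int j(u_1-u_2+\lambda(v_1-v_2))\,d\nu$ for all convex lower semicontinuous $j:\mathbb R\to[0,\infty]$ with $j(0)=0$. *)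

theory Defs
  imports "HOL-Analysis.Analysis" "HOL-Probability.Probability"
begin

text \<open>Random walk spaces. The measurable space is carried by the measure nu
  (space nu, sets nu); m x is the probability measure m_x.\<close>

definition nu_m :: "'a measure \<Rightarrow> ('a \<Rightarrow> 'a measure) \<Rightarrow> ('a \<times> 'a) measure" where
  "nu_m nu m = measure_of (space nu \<times> space nu) (sets (nu \<Otimes>\<^sub>M nu))
     (\<lambda>C. \<integral>\<^sup>+ x. (\<integral>\<^sup>+ y. indicator C (x, y) \<partial>(m x)) \<partial>nu)"

definition random_walk_space :: "'a measure \<Rightarrow> ('a \<Rightarrow> 'a measure) \<Rightarrow> bool" where
  "random_walk_space nu m \<longleftrightarrow>
     (\<exists>G. countable G \<and> sets nu = sigma_sets (space nu) G) \<and>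
     (\<forall>x\<in>space nu. prob_space (m x) \<and> sets (m x) = sets nu) \<and>
     (\<forall>B\<in>sets nu. (\<lambda>x. emeasure (m x) B) \<in> borel_measurable nu) \<and>
     sigma_finite_measure nu \<and>
     (\<forall>A\<in>sets nu. emeasure nu A = (\<integral>\<^sup>+ x. emeasure (m x) A \<partial>nu))"

definition reversible :: "'a measure \<Rightarrow> ('a \<Rightarrow> 'a measure) \<Rightarrow> bool" where
  "reversible nu m \<longleftrightarrow>
     distr (nu_m nu m) (nu \<Otimes>\<^sub>M nu) (\<lambda>(x, y). (y, x)) = nu_m nu m"

definition L2 :: "'a measure \<Rightarrow> ('a \<Rightarrow> real) set" where
  "L2 nu = {u. u \<in> borel_measurable nu \<and> integrable nu (\<lambda>x. (u x)\<^sup>2)}"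

definition grad :: "('a \<Rightarrow> real) \<Rightarrow> 'a \<Rightarrow> 'a \<Rightarrow> real" where
  "grad u x y = u y - u x"

definition Kker :: "('a \<Rightarrow> 'a set) \<Rightarrow> 'a \<Rightarrow> 'a \<Rightarrow> real" where
  "Kker A x y = (indicator (A x) y + indicator (A y) x) / 2"

definition F_1 :: "'a measure \<Rightarrow> ('a \<Rightarrow> 'a measure) \<Rightarrow> ('a \<Rightarrow> 'a set)
                    \<Rightarrow> ('a \<Rightarrow> real) \<Rightarrow> ennreal" where
  "F_1 nu m A u = (\<integral>\<^sup>+ z. ennreal (\<bar>grad u (fst z) (snd z)\<bar> * Kker A (fst z) (snd z) / 2)
                      \<partial>(nu_m nu m))"

definition F_p :: "'a measure \<Rightarrow> ('a \<Rightarrow> 'a measure) \<Rightarrow> ('a \<Rightarrow> 'a set) \<Rightarrow> real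
                    \<Rightarrow> ('a \<Rightarrow> real) \<Rightarrow> ennreal" where
  "F_p nu m B p u = (\<integral>\<^sup>+ z. ennreal (\<bar>grad u (fst z) (snd z)\<bar> powr p * Kker B (fst z) (snd z)
                       / (2 * p)) \<partial>(nu_m nu m))"

definition subdiff :: "'a measure \<Rightarrow> (('a \<Rightarrow> real) \<Rightarrow> ennreal)
                        \<Rightarrow> (('a \<Rightarrow> real) \<times> ('a \<Rightarrow> real)) set" where
  "subdiff nu F = {(u, v). u \<in> L2 nu \<and> v \<in> L2 nu \<and> F u \<noteq> \<infinity> \<and>
      (\<forall>w\<in>L2 nu. enn2ereal (F u) + ereal (\<integral>x. v x * (w x - u x) \<partial>nu) \<le> enn2ereal (F w))}"

definition op_sum :: "(('a \<Rightarrow> real) \<times> ('a \<Rightarrow> real)) set \<Rightarrow> (('a \<Rightarrow> real) \<times> ('a \<Rightarrow> real)) set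
                       \<Rightarrow> (('a \<Rightarrow> real) \<times> ('a \<Rightarrow> real)) set" where
  "op_sum A1 A2 = {(u, \<lambda>x. v1 x + v2 x) | u v1 v2. (u, v1) \<in> A1 \<and> (u, v2) \<in> A2}"

definition op_neg :: "(('a \<Rightarrow> real) \<times> ('a \<Rightarrow> real)) set \<Rightarrow> (('a \<Rightarrow> real) \<times> ('a \<Rightarrow> real)) set" where
  "op_neg A = {(u, \<lambda>x. - v x) | u v. (u, v) \<in> A}"

definition Delta_1 :: "'a measure \<Rightarrow> ('a \<Rightarrow> 'a measure) \<Rightarrow> ('a \<Rightarrow> 'a set)
                        \<Rightarrow> (('a \<Rightarrow> real) \<times> ('a \<Rightarrow> real)) set" where
  "Delta_1 nu m A = {(u, v). (u, \<lambda>x. - v x) \<in> subdiff nu (F_1 nu m A)}"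

definition Delta_p :: "'a measure \<Rightarrow> ('a \<Rightarrow> 'a measure) \<Rightarrow> ('a \<Rightarrow> 'a set) \<Rightarrow> real
                        \<Rightarrow> (('a \<Rightarrow> real) \<times> ('a \<Rightarrow> real)) set" where
  "Delta_p nu m B p = {(u, v). u \<in> L2 nu \<and> v \<in> L2 nu \<and>
      (\<integral>\<^sup>+ z. ennreal (Kker B (fst z) (snd z) * \<bar>grad u (fst z) (snd z)\<bar> powr p) \<partial>(nu_m nu m)) < \<infinity> \<and>
      (AE x in nu. integrable (m x)
          (\<lambda>y. Kker B x y * \<bar>grad u x y\<bar> powr (p - 2) * grad u x y) \<and>
        v x = (\<integral>y. Kker B x y * \<bar>grad u x y\<bar> powr (p - 2) * grad u x y \<partial>(m x)))}"

definition convex_enn :: "(real \<Rightarrow> ennreal) \<Rightarrow> bool" where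
  "convex_enn j \<longleftrightarrow> (\<forall>x y t. 0 \<le> t \<and> t \<le> 1 \<longrightarrow>
      j ((1 - t) * x + t * y) \<le> ennreal (1 - t) * j x + ennreal t * j y)"

definition lsc_enn :: "(real \<Rightarrow> ennreal) \<Rightarrow> bool" where
  "lsc_enn j \<longleftrightarrow> (\<forall>x xs. xs \<longlonglongrightarrow> x \<longrightarrow> j x \<le> liminf (\<lambda>n. j (xs n)))"

definition completely_accretive :: "'a measure \<Rightarrow> (('a \<Rightarrow> real) \<times> ('a \<Rightarrow> real)) set \<Rightarrow> bool" where
  "completely_accretive nu Op \<longleftrightarrow>
     Op \<subseteq> L2 nu \<times> L2 nu \<and>
     (\<forall>lam>0. \<forall>(u1, v1)\<in>Op. \<forall>(u2, v2)\<in>Op. \<forall>j. convex_enn j \<and> lsc_enn j \<and> j 0 = 0 \<longrightarrow>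
        (\<integral>\<^sup>+ x. j (u1 x - u2 x) \<partial>nu) \<le>
        (\<integral>\<^sup>+ x. j (u1 x - u2 x + lam * (v1 x - v2 x)) \<partial>nu))"

definition op_dom :: "(('a \<Rightarrow> real) \<times> ('a \<Rightarrow> real)) set \<Rightarrow> ('a \<Rightarrow> real) set" where
  "op_dom Op = fst ` Op"

definition dense_L2 :: "'a measure \<Rightarrow> ('a \<Rightarrow> real) set \<Rightarrow> bool" where
  "dense_L2 nu D \<longleftrightarrow> D \<subseteq> L2 nu \<and>
     (\<forall>w\<in>L2 nu. \<forall>e>0. \<exists>u\<in>D. (\<integral>x. (w x - u x)\<^sup>2 \<partial>nu) < e)"

end

theory Submission
  imports Defs
begin

text \<open>
  Write \<open>G\<close> for an antisymmetric field on \<open>X \<times> X\<close> and \<open>V x\<close> for its \<open>m x\<close>-mean. Reversibility gives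
  the integration by parts \<open>1/2 \<integral> G \<nabla>f d(\<nu> \<otimes> m) = - \<integral> V f d\<nu>\<close>. Since the \<open>p\<close>-energy is
  differentiable along bounded \<open>L2\<close> directions, \<open>(u, v) \<in> \<partial>(F_1 + F_p)\<close> implies
  \<open>\<integral> (v + \<Delta>_p u) f \<le> F_1 (u + f) - F_1 u \<le> \<integral> \<bar>f\<bar>\<close> for these directions, hence
  \<open>\<bar>v + \<Delta>_p u\<bar> \<le> 1\<close>. This bound forces \<open>\<Delta>_p u \<in> L2\<close> (trivially if \<open>\<nu>\<close> is finite, and by splitting
  the flux at \<open>\<bar>\<nabla>u\<bar> = 1\<close> if \<open>p \<ge> 2\<close>), and truncating the direction shows \<open>v + \<Delta>_p u \<in> \<partial>F_1 u\<close>.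

  For complete accretivity, \<open>F (u1 - R (u1 - u2)) + F (u2 + R (u1 - u2)) \<le> F u1 + F u2\<close> for every
  nondecreasing contraction \<open>R\<close> with \<open>R 0 = 0\<close>, by convexity of the integrands; taking for \<open>R\<close> the
  rescaled derivatives of the Moreau envelopes of \<open>j\<close> and passing to the limit gives the inequality
  for \<open>j\<close>. Density holds because every bounded function supported on a set of finite measure is in
  the domain: the field \<open>K_A sgn \<nabla>u + K_B \<bar>\<nabla>u\<bar>^(p-2) \<nabla>u\<close> is then square integrable.
\<close>

section \<open>The measure \<open>dm_x(y) d\<nu>(x)\<close>\<close>

text \<open>The hard inclusion in the sum rule is the splitting of a given subgradient
  \<open>v\<close>. On an infinite measure space \<open>F_1\<close> may be infinite on part of L2,
  and so may \<open>F_p\<close> when \<open>p > 2\<close>, so the usual criterion, continuity of one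
  summand at a point of the other's domain, is not at hand. Bounded directions \<open>f\<close> in
  L2 replace it: either hypothesis makes \<open>\<bar>f\<bar> powr p\<close> integrable, so
  \<open>u + t * f\<close> keeps finite p-energy and the p-energy contributes a linear term to the
  variation. The bound 1 is a Lipschitz constant of \<open>F_1\<close> for the L1 norm: the factor
  1/2 in \<open>F_1\<close>, the bound \<open>Kker A x y \<le> 1\<close> and the fact that both
  marginals of \<open>nu_m nu m\<close> are \<open>nu\<close> give
  \<open>F_1 f \<le> \<integral> \<bar>f\<bar>\<close>. Subgradients of \<open>F_1\<close> are not
  represented by antisymmetric fields; what remains of \<open>v\<close> after removing the
  p-Laplacian satisfies the subgradient inequality itself. Complete accretivity is proved for the
  subdifferential of the sum directly, from an inequality between energies instead of a formula for
  the operator.\<close>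

locale reversible_walk =
  fixes nu :: "'a measure" and m :: "'a \<Rightarrow> 'a measure"
  assumes walk: "random_walk_space nu m" and rev: "reversible nu m"
begin

lemma prob_space_m: "x \<in> space nu \<Longrightarrow> prob_space (m x)"
  and sets_m: "x \<in> space nu \<Longrightarrow> sets (m x) = sets nu"
  and sigma_finite_nu: "sigma_finite_measure nu"
  using walk by (auto simp: random_walk_space_def)

lemma kernel_measurable [measurable]: "m \<in> measurable nu (subprob_algebra nu)"
  using walk unfolding random_walk_space_def
  by (intro measurable_subprob_algebra) (auto intro: prob_space_imp_subprob_space)

lemma space_m: "x \<in> space nu \<Longrightarrow> space (m x) = space nu"
  using sets_m by (rule sets_eq_imp_space_eq)

lemma measurable_section:
  assumes "f \<in> borel_measurable (nu \<Otimes>\<^sub>M nu)" "x \<in> space nu"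
  shows "(\<lambda>y. f (x, y)) \<in> borel_measurable (m x)"
proof -
  have "(\<lambda>y. f (x, y)) \<in> borel_measurable nu"
    using assms by measurable
  then show ?thesis
    using measurable_cong_sets[OF sets_m[OF assms(2)] refl] by blast
qed

lemma measurable_kernel_nn_integral:
  assumes "f \<in> borel_measurable (nu \<Otimes>\<^sub>M nu)"
  shows "(\<lambda>x. \<integral>\<^sup>+ y. f (x, y) \<partial>(m x)) \<in> borel_measurable nu"
  by (rule nn_integral_measurable_subprob_algebra2[where N = nu]) (use assms in \<open>auto\<close>)

lemma measurable_kernel_integral:
  fixes f :: "'a \<times> 'a \<Rightarrow> real"
  assumes f[measurable]: "f \<in> borel_measurable (nu \<Otimes>\<^sub>M nu)"
  shows "(\<lambda>x. \<integral>y. f (x, y) \<partial>(m x)) \<in> borel_measurable nu"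
proof -
  note measurable_distr2[measurable]
  \<comment> \<open>Pushing \<open>m x\<close> forward along \<open>y \<mapsto> (x, y)\<close> moves
    the dependence on \<open>x\<close> from the integrand to the measure, where measurability of the
    integral is that of a kernel.\<close>
  have "(\<lambda>x. integral\<^sup>L (distr (m x) (nu \<Otimes>\<^sub>M nu) (\<lambda>y. (x, y))) f) \<in> borel_measurable nu"
    by measurable
  then show ?thesis
    by (rule measurable_cong[THEN iffD1, rotated])
       (auto intro!: integral_distr measurable_Pair simp: measurable_cong_sets[OF sets_m])
qed

lemma sets_nu_m [measurable_cong]: "sets (nu_m nu m) = sets (nu \<Otimes>\<^sub>M nu)"
proof -
  have "sigma_sets (space nu \<times> space nu) (sets (nu \<Otimes>\<^sub>M nu)) = sets (nu \<Otimes>\<^sub>M nu)"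
    using sets.sigma_sets_eq[of "nu \<Otimes>\<^sub>M nu"] by (simp add: space_pair_measure)
  then show ?thesis
    using sets.space_closed[of "nu \<Otimes>\<^sub>M nu"] by (simp add: nu_m_def space_pair_measure)
qed

lemma space_nu_m: "space (nu_m nu m) = space nu \<times> space nu"
  using sets_eq_imp_space_eq[OF sets_nu_m] by (simp add: space_pair_measure)

text \<open>\<open>measure_of\<close> agrees with the prescribed set function only if that function
  is countably additive, which here means exchanging a series with both integrals.\<close>

lemma emeasure_nu_m:
  assumes "C \<in> sets (nu \<Otimes>\<^sub>M nu)"
  shows "emeasure (nu_m nu m) C = (\<integral>\<^sup>+ x. (\<integral>\<^sup>+ y. indicator C (x, y) \<partial>(m x)) \<partial>nu)"
proof (rule emeasure_measure_of[OF nu_m_def])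
  show "sets (nu \<Otimes>\<^sub>M nu) \<subseteq> Pow (space nu \<times> space nu)"
    using sets.space_closed[of "nu \<Otimes>\<^sub>M nu"] by (simp add: space_pair_measure)
  show "positive (sets (nu_m nu m)) (\<lambda>C. \<integral>\<^sup>+ x. (\<integral>\<^sup>+ y. indicator C (x, y) \<partial>(m x)) \<partial>nu)"
    by (simp add: positive_def)
  show "countably_additive (sets (nu_m nu m)) (\<lambda>C. \<integral>\<^sup>+ x. (\<integral>\<^sup>+ y. indicator C (x, y) \<partial>(m x)) \<partial>nu)"
  proof (rule countably_additiveI)
    fix D :: "nat \<Rightarrow> ('a \<times> 'a) set"
    assume D: "range D \<subseteq> sets (nu_m nu m)" and dis: "disjoint_family D"
    have [measurable]: "D i \<in> sets (nu \<Otimes>\<^sub>M nu)" for i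
      using D sets_nu_m by auto
    have ind: "(\<lambda>z. indicator (D i) z :: ennreal) \<in> borel_measurable (nu \<Otimes>\<^sub>M nu)" for i
      by measurable
    have "(\<Sum>i. \<integral>\<^sup>+ x. (\<integral>\<^sup>+ y. indicator (D i) (x, y) \<partial>(m x)) \<partial>nu)
        = (\<integral>\<^sup>+ x. (\<Sum>i. \<integral>\<^sup>+ y. indicator (D i) (x, y) \<partial>(m x)) \<partial>nu)"
      by (intro nn_integral_suminf[symmetric] measurable_kernel_nn_integral ind)
    also have "\<dots> = (\<integral>\<^sup>+ x. (\<integral>\<^sup>+ y. (\<Sum>i. indicator (D i) (x, y)) \<partial>(m x)) \<partial>nu)"
      by (intro nn_integral_cong nn_integral_suminf[symmetric] measurable_section[OF ind])
    also have "\<dots> = (\<integral>\<^sup>+ x. (\<integral>\<^sup>+ y. indicator (\<Union>i. D i) (x, y) \<partial>(m x)) \<partial>nu)"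
      by (simp add: suminf_indicator[OF dis])
    finally show "(\<Sum>i. \<integral>\<^sup>+ x. (\<integral>\<^sup>+ y. indicator (D i) (x, y) \<partial>(m x)) \<partial>nu)
      = (\<integral>\<^sup>+ x. (\<integral>\<^sup>+ y. indicator (\<Union>i. D i) (x, y) \<partial>(m x)) \<partial>nu)" .
  qed
qed (use assms sets_nu_m in auto)

lemma nn_integral_nu_m:
  assumes "f \<in> borel_measurable (nu \<Otimes>\<^sub>M nu)"
  shows "(\<integral>\<^sup>+ z. f z \<partial>(nu_m nu m)) = (\<integral>\<^sup>+ x. (\<integral>\<^sup>+ y. f (x, y) \<partial>(m x)) \<partial>nu)"
  using assms
proof (induction rule: borel_measurable_induct)
  case (cong f g)
  have "(\<integral>\<^sup>+ z. f z \<partial>(nu_m nu m)) = (\<integral>\<^sup>+ z. g z \<partial>(nu_m nu m))"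
    using cong by (intro nn_integral_cong) (auto simp: space_nu_m space_pair_measure)
  moreover have "(\<integral>\<^sup>+ x. (\<integral>\<^sup>+ y. f (x, y) \<partial>(m x)) \<partial>nu) = (\<integral>\<^sup>+ x. (\<integral>\<^sup>+ y. g (x, y) \<partial>(m x)) \<partial>nu)"
    using cong by (intro nn_integral_cong) (auto simp: space_m space_pair_measure)
  ultimately show ?case using cong by simp
next
  case (set C)
  then show ?case by (simp add: sets_nu_m emeasure_nu_m)
next
  case (mult f c)
  then have [measurable]: "f \<in> borel_measurable (nu \<Otimes>\<^sub>M nu)" by simp
  have "(\<integral>\<^sup>+ x. (\<integral>\<^sup>+ y. c * f (x, y) \<partial>(m x)) \<partial>nu) = (\<integral>\<^sup>+ x. c * (\<integral>\<^sup>+ y. f (x, y) \<partial>(m x)) \<partial>nu)"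
    by (intro nn_integral_cong nn_integral_cmult measurable_section) auto
  also have "\<dots> = c * (\<integral>\<^sup>+ x. (\<integral>\<^sup>+ y. f (x, y) \<partial>(m x)) \<partial>nu)"
    by (intro nn_integral_cmult measurable_kernel_nn_integral) auto
  finally show ?case using mult by (simp add: nn_integral_cmult)
next
  case (add f g)
  then have [measurable]: "f \<in> borel_measurable (nu \<Otimes>\<^sub>M nu)" "g \<in> borel_measurable (nu \<Otimes>\<^sub>M nu)" by auto
  have "(\<integral>\<^sup>+ x. (\<integral>\<^sup>+ y. g (x, y) + f (x, y) \<partial>(m x)) \<partial>nu)
      = (\<integral>\<^sup>+ x. (\<integral>\<^sup>+ y. g (x, y) \<partial>(m x)) + (\<integral>\<^sup>+ y. f (x, y) \<partial>(m x)) \<partial>nu)"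
    by (intro nn_integral_cong nn_integral_add measurable_section) auto
  also have "\<dots> = (\<integral>\<^sup>+ x. (\<integral>\<^sup>+ y. g (x, y) \<partial>(m x)) \<partial>nu) + (\<integral>\<^sup>+ x. (\<integral>\<^sup>+ y. f (x, y) \<partial>(m x)) \<partial>nu)"
    by (intro nn_integral_add measurable_kernel_nn_integral) auto
  finally show ?case using add by (simp add: nn_integral_add)
next
  case (seq U)
  then have [measurable]: "U i \<in> borel_measurable (nu \<Otimes>\<^sub>M nu)" for i by auto
  have inc: "incseq U" by fact
  have "(\<integral>\<^sup>+ x. (\<integral>\<^sup>+ y. (SUP i. U i (x, y)) \<partial>(m x)) \<partial>nu)
      = (\<integral>\<^sup>+ x. (SUP i. \<integral>\<^sup>+ y. U i (x, y) \<partial>(m x)) \<partial>nu)"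
    using inc by (intro nn_integral_cong nn_integral_monotone_convergence_SUP measurable_section)
      (auto simp: incseq_def le_fun_def)
  also have "\<dots> = (SUP i. \<integral>\<^sup>+ x. (\<integral>\<^sup>+ y. U i (x, y) \<partial>(m x)) \<partial>nu)"
    using inc by (intro nn_integral_monotone_convergence_SUP measurable_kernel_nn_integral)
      (auto simp: incseq_def le_fun_def intro!: nn_integral_mono)
  also have "\<dots> = (SUP i. \<integral>\<^sup>+ z. U i z \<partial>(nu_m nu m))"
    using seq by simp
  also have "\<dots> = (\<integral>\<^sup>+ z. (SUP i. U i z) \<partial>(nu_m nu m))"
    using inc by (intro nn_integral_monotone_convergence_SUP[symmetric]) auto
  finally show ?case by (simp add: image_image)
qed

section \<open>Reversibility, marginals and Fubini\<close>

lemma swap_measurable: "(\<lambda>(x, y). (y, x)) \<in> measurable (nu_m nu m) (nu \<Otimes>\<^sub>M nu)"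
  by measurable

lemma integral_nu_m_swap:
  fixes f :: "'a \<times> 'a \<Rightarrow> real"
  assumes "f \<in> borel_measurable (nu \<Otimes>\<^sub>M nu)"
  shows "(\<integral>z. f (snd z, fst z) \<partial>(nu_m nu m)) = (\<integral>z. f z \<partial>(nu_m nu m))"
proof -
  have "(\<integral>z. f z \<partial>(nu_m nu m))
      = (\<integral>z. f z \<partial>(distr (nu_m nu m) (nu \<Otimes>\<^sub>M nu) (\<lambda>(x, y). (y, x))))"
    using rev by (simp add: reversible_def)
  also have "\<dots> = (\<integral>z. f (snd z, fst z) \<partial>(nu_m nu m))"
    using assms by (subst integral_distr[OF swap_measurable]) (auto simp: case_prod_beta)
  finally show ?thesis by simp
qed

lemma integrable_nu_m_swap:
  fixes f :: "'a \<times> 'a \<Rightarrow> real"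
  assumes "integrable (nu_m nu m) f"
  shows "integrable (nu_m nu m) (\<lambda>z. f (snd z, fst z))"
proof -
  have "integrable (distr (nu_m nu m) (nu \<Otimes>\<^sub>M nu) (\<lambda>(x, y). (y, x))) f"
    using rev assms by (simp add: reversible_def)
  then show ?thesis
    by (drule_tac integrable_distr[OF swap_measurable]) (simp add: case_prod_beta)
qed

lemma nn_integral_nu_m_fst:
  assumes [measurable]: "h \<in> borel_measurable nu"
  shows "(\<integral>\<^sup>+ z. h (fst z) \<partial>(nu_m nu m)) = (\<integral>\<^sup>+ x. h x \<partial>nu)"
proof -
  have "(\<integral>\<^sup>+ z. h (fst z) \<partial>(nu_m nu m)) = (\<integral>\<^sup>+ x. (\<integral>\<^sup>+ y. h x \<partial>(m x)) \<partial>nu)"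
    by (subst nn_integral_nu_m) auto
  also have "\<dots> = (\<integral>\<^sup>+ x. h x \<partial>nu)"
    by (intro nn_integral_cong) (simp add: prob_space.emeasure_space_1[OF prob_space_m])
  finally show ?thesis .
qed

text \<open>The first marginal of \<open>nu_m nu m\<close> is \<open>nu\<close> because each
  \<open>m x\<close> has mass 1; by reversibility so is the second one, which
  \<open>integrable_nu_m_snd\<close> uses.\<close>

lemma integrable_nu_m_fst:
  fixes h :: "'a \<Rightarrow> real"
  assumes "integrable nu h"
  shows "integrable (nu_m nu m) (\<lambda>z. h (fst z))"
proof -
  have [measurable]: "h \<in> borel_measurable nu" using assms by simp
  show ?thesis
    using assms nn_integral_nu_m_fst[of "\<lambda>x. ennreal (norm (h x))"]
    by (auto simp: integrable_iff_bounded)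
qed

lemma integrable_nu_m_snd:
  fixes h :: "'a \<Rightarrow> real"
  assumes "integrable nu h"
  shows "integrable (nu_m nu m) (\<lambda>z. h (snd z))"
  using integrable_nu_m_swap[OF integrable_nu_m_fst[OF assms]] by simp

lemma AE_nu_m_section:
  fixes f :: "'a \<times> 'a \<Rightarrow> real"
  assumes f: "integrable (nu_m nu m) f"
  shows "AE x in nu. integrable (m x) (\<lambda>y. f (x, y))"
proof -
  have fm[measurable]: "f \<in> borel_measurable (nu \<Otimes>\<^sub>M nu)"
    using f borel_measurable_integrable measurable_cong_sets[OF sets_nu_m refl] by blast
  have "(\<integral>\<^sup>+ x. (\<integral>\<^sup>+ y. ennreal (norm (f (x, y))) \<partial>(m x)) \<partial>nu) < \<infinity>"
    using f nn_integral_nu_m[of "\<lambda>z. ennreal (norm (f z))"] by (simp add: integrable_iff_bounded)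
  then have "AE x in nu. (\<integral>\<^sup>+ y. ennreal (norm (f (x, y))) \<partial>(m x)) \<noteq> \<infinity>"
    using measurable_kernel_nn_integral[of "\<lambda>z. ennreal (norm (f z))"]
    by (intro nn_integral_PInf_AE) auto
  then show ?thesis
    using AE_space
  proof eventually_elim
    case (elim x)
    then show ?case
      using measurable_section[OF fm, of x] by (simp add: integrable_iff_bounded less_top)
  qed
qed

lemma
  fixes f :: "'a \<times> 'a \<Rightarrow> real"
  assumes f: "integrable (nu_m nu m) f"
  shows integrable_nu_m_Fubini: "integrable nu (\<lambda>x. \<integral>y. f (x, y) \<partial>(m x))"
    and integral_nu_m_Fubini: "(\<integral>z. f z \<partial>(nu_m nu m)) = (\<integral>x. (\<integral>y. f (x, y) \<partial>(m x)) \<partial>nu)"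
proof -
  have fm[measurable]: "f \<in> borel_measurable (nu \<Otimes>\<^sub>M nu)"
    using f borel_measurable_integrable measurable_cong_sets[OF sets_nu_m refl] by blast
  \<comment> \<open>Tonelli settles nonnegative integrands. The general case is the difference of
    positive and negative parts, which is legitimate in the sections only for almost every
    \<open>x\<close>.\<close>
  have part: "integrable nu (\<lambda>x. \<integral>y. g (x, y) \<partial>(m x)) \<and>
      (\<integral>z. g z \<partial>(nu_m nu m)) = (\<integral>x. (\<integral>y. g (x, y) \<partial>(m x)) \<partial>nu)"
    if g: "integrable (nu_m nu m) g" and nn: "\<And>z. g z \<ge> 0" for g :: "'a \<times> 'a \<Rightarrow> real"
  proof -
    have gm[measurable]: "g \<in> borel_measurable (nu \<Otimes>\<^sub>M nu)"
      using g borel_measurable_integrable measurable_cong_sets[OF sets_nu_m refl] by blast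
    have Vm[measurable]: "(\<lambda>x. \<integral>y. g (x, y) \<partial>(m x)) \<in> borel_measurable nu"
      by (rule measurable_kernel_integral) simp
    have "ennreal (\<integral>z. g z \<partial>(nu_m nu m)) = (\<integral>\<^sup>+ z. ennreal (g z) \<partial>(nu_m nu m))"
      using g nn by (simp add: nn_integral_eq_integral)
    also have "\<dots> = (\<integral>\<^sup>+ x. (\<integral>\<^sup>+ y. ennreal (g (x, y)) \<partial>(m x)) \<partial>nu)"
      by (rule nn_integral_nu_m) simp
    also have "\<dots> = (\<integral>\<^sup>+ x. ennreal (\<integral>y. g (x, y) \<partial>(m x)) \<partial>nu)"
      using AE_nu_m_section[OF g]
      by (intro nn_integral_cong_AE, eventually_elim) (auto intro!: nn_integral_eq_integral nn)
    finally have eq: "(\<integral>\<^sup>+ x. ennreal (\<integral>y. g (x, y) \<partial>(m x)) \<partial>nu) = ennreal (\<integral>z. g z \<partial>(nu_m nu m))" ..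
    have nnV: "(\<integral>y. g (x, y) \<partial>(m x)) \<ge> 0" for x
      using nn by simp
    have i: "integrable nu (\<lambda>x. \<integral>y. g (x, y) \<partial>(m x))"
      using eq nnV by (intro integrableI_nonneg) auto
    have "ennreal (\<integral>x. (\<integral>y. g (x, y) \<partial>(m x)) \<partial>nu) = ennreal (\<integral>z. g z \<partial>(nu_m nu m))"
      using nn_integral_eq_integral[OF i] eq nnV by simp
    then show ?thesis using i nn nnV by (simp add: integral_nonneg_AE)
  qed
  let ?P = "\<lambda>z. max 0 (f z)" and ?N = "\<lambda>z. max 0 (- f z)"
  have ip: "integrable (nu_m nu m) ?P" and iN: "integrable (nu_m nu m) ?N"
    using f by auto
  have fP: "f z = ?P z - ?N z" for z by (simp add: max_def)
  note p = part[OF ip] part[OF iN]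
  have AEeq: "AE x in nu. (\<integral>y. f (x, y) \<partial>(m x)) = (\<integral>y. ?P (x, y) \<partial>(m x)) - (\<integral>y. ?N (x, y) \<partial>(m x))"
    using AE_nu_m_section[OF ip] AE_nu_m_section[OF iN]
  proof eventually_elim
    case (elim x)
    then show ?case by (subst fP) (rule Bochner_Integration.integral_diff)
  qed
  have d: "integrable nu (\<lambda>x. (\<integral>y. ?P (x, y) \<partial>(m x)) - (\<integral>y. ?N (x, y) \<partial>(m x)))"
    using p by auto
  have Vm: "(\<lambda>x. \<integral>y. f (x, y) \<partial>(m x)) \<in> borel_measurable nu"
    by (rule measurable_kernel_integral) simp
  show "integrable nu (\<lambda>x. \<integral>y. f (x, y) \<partial>(m x))"
    using d AEeq Vm borel_measurable_integrable[OF d] by (subst integrable_cong_AE)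
  have "(\<integral>z. f z \<partial>(nu_m nu m)) = (\<integral>z. ?P z \<partial>(nu_m nu m)) - (\<integral>z. ?N z \<partial>(nu_m nu m))"
    by (subst fP) (rule Bochner_Integration.integral_diff[OF ip iN])
  also have "\<dots> = (\<integral>x. (\<integral>y. ?P (x, y) \<partial>(m x)) - (\<integral>y. ?N (x, y) \<partial>(m x)) \<partial>nu)"
    using p by simp
  also have "\<dots> = (\<integral>x. (\<integral>y. f (x, y) \<partial>(m x)) \<partial>nu)"
    using AEeq Vm borel_measurable_integrable[OF d] by (intro integral_cong_AE) auto
  finally show "(\<integral>z. f z \<partial>(nu_m nu m)) = (\<integral>x. (\<integral>y. f (x, y) \<partial>(m x)) \<partial>nu)" .
qed

end

section \<open>Convex functions of a real variable\<close>

text \<open>Averaging the supporting line at \<open>z\<close> over the two endpoints cancels the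
  slope. It serves the absolute value, powers and Moreau envelopes, each of which comes with
  explicit supporting lines.\<close>

lemma convex_on_subgradients:
  fixes f :: "real \<Rightarrow> real"
  assumes "\<And>s t. f s + k s * (t - s) \<le> f t"
  shows "convex_on UNIV f"
proof (rule convex_onI)
  fix t x y :: real
  assume t: "0 < t" "t < 1"
  define z where "z = (1 - t) *\<^sub>R x + t *\<^sub>R y"
  have "(1 - t) * (f z + k z * (x - z)) + t * (f z + k z * (y - z)) \<le> (1 - t) * f x + t * f y"
    using t by (intro add_mono mult_left_mono assms) auto
  moreover have "(1 - t) * (f z + k z * (x - z)) + t * (f z + k z * (y - z)) = f z"
    by (simp add: z_def algebra_simps)
  ultimately show "f ((1 - t) *\<^sub>R x + t *\<^sub>R y) \<le> (1 - t) * f x + t * f y"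
    by (simp add: z_def)
qed auto

text \<open>\<open>D\<close> is a fraction \<open>t\<close> of \<open>a - b\<close>, so
  \<open>a - D\<close> and \<open>b + D\<close> are convex combinations of \<open>a\<close> and
  \<open>b\<close> with exchanged weights, and the two convexity inequalities add up. This is the
  pointwise source of complete accretivity.\<close>

lemma convex_on_exchange:
  fixes f :: "real \<Rightarrow> real"
  assumes f: "convex_on UNIV f" and D: "0 \<le> D \<and> D \<le> a - b \<or> a - b \<le> D \<and> D \<le> 0"
  shows "f (a - D) + f (b + D) \<le> f a + f b"
proof (cases "a = b")
  case True
  then show ?thesis using D by auto
next
  case False
  define t where "t = D / (a - b)"
  have t: "0 \<le> t" "t \<le> 1" and Dt: "D = t * (a - b)"
    using D False by (auto simp: t_def divide_simps)
  have "f ((1 - t) *\<^sub>R a + t *\<^sub>R b) \<le> (1 - t) * f a + t * f b"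
    "f ((1 - t) *\<^sub>R b + t *\<^sub>R a) \<le> (1 - t) * f b + t * f a"
    using t by (intro convex_onD[OF f]; simp)+
  moreover have "(1 - t) *\<^sub>R a + t *\<^sub>R b = a - D" "(1 - t) *\<^sub>R b + t *\<^sub>R a = b + D"
    by (auto simp: Dt algebra_simps)
  ultimately have "f (a - D) \<le> (1 - t) * f a + t * f b" "f (b + D) \<le> (1 - t) * f b + t * f a"
    by metis+
  then show ?thesis by (simp add: algebra_simps)
qed

section \<open>Absolute value, powers and their subgradients\<close>

lemma abs_subgradient: "\<bar>a\<bar> + sgn a * (b - a) \<le> \<bar>b :: real\<bar>"
  by (auto simp: sgn_if abs_if)

text \<open>The derivative of \<open>\<bar>a\<bar> powr p / p\<close>. The factor \<open>a\<close>
  gives the value 0 at the origin for every \<open>p\<close>, also when the exponent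
  \<open>p - 2\<close> is negative.\<close>

definition signed_pow :: "real \<Rightarrow> real \<Rightarrow> real" where
  "signed_pow p a = \<bar>a\<bar> powr (p - 2) * a"

lemma signed_pow_0 [simp]: "signed_pow p 0 = 0"
  by (simp add: signed_pow_def)

lemma signed_pow_minus: "signed_pow p (- a) = - signed_pow p a"
  by (simp add: signed_pow_def)

lemma abs_signed_pow: "\<bar>signed_pow p a\<bar> = \<bar>a\<bar> powr (p - 1)"
proof (cases "a = 0")
  case False
  then have "\<bar>a\<bar> powr (p - 2) * \<bar>a\<bar> = \<bar>a\<bar> powr (p - 2) * \<bar>a\<bar> powr 1" by simp
  also have "\<dots> = \<bar>a\<bar> powr (p - 1)" by (subst powr_add[symmetric]) simp
  finally show ?thesis by (simp add: signed_pow_def abs_mult)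
qed (simp add: signed_pow_def)

lemma powr_pred_mult: "a \<ge> 0 \<Longrightarrow> a powr (p - 1) * a = a powr p" for a p :: real
  by (cases "a = 0") (simp_all add: powr_diff)

lemma signed_pow_mult_self: "signed_pow p a * a = \<bar>a\<bar> powr p"
proof -
  have "signed_pow p a * a = \<bar>a\<bar> powr (p - 2) * \<bar>a\<bar> * \<bar>a\<bar>"
    by (simp add: signed_pow_def)
  also have "\<dots> = \<bar>signed_pow p a\<bar> * \<bar>a\<bar>"
    by (simp add: signed_pow_def abs_mult)
  finally show ?thesis
    using powr_pred_mult[of "\<bar>a\<bar>" p] by (simp add: abs_signed_pow)
qed

text \<open>Young's inequality for \<open>\<bar>a\<bar> powr (p - 1)\<close> and
  \<open>\<bar>b\<bar>\<close>, with the conjugate exponent \<open>q\<close> satisfying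
  \<open>(p - 1) * q = p\<close>.\<close>

lemma powr_subgradient:
  assumes p: "p > 1"
  shows "\<bar>a\<bar> powr p / p + signed_pow p a * (b - a) \<le> \<bar>b\<bar> powr p / p"
proof -
  define q where "q = p / (p - 1)"
  have q: "q > 1" "1 / q + 1 / p = 1" "(p - 1) * q = p"
    using p by (auto simp: q_def field_simps)
  have "signed_pow p a * b \<le> \<bar>signed_pow p a\<bar> * \<bar>b\<bar>"
    by (metis abs_ge_self abs_mult)
  also have "\<dots> = \<bar>a\<bar> powr (p - 1) * \<bar>b\<bar>"
    by (simp add: abs_signed_pow)
  also have "\<dots> \<le> (\<bar>a\<bar> powr (p - 1)) powr q / q + \<bar>b\<bar> powr p / p"
    using p q by (intro Youngs_inequality) auto
  also have "(\<bar>a\<bar> powr (p - 1)) powr q / q = (1 - 1 / p) * \<bar>a\<bar> powr p"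
  proof -
    have "(1 - 1 / p) = 1 / q" using q(2) by simp
    then show ?thesis using q(3) by (simp add: powr_powr)
  qed
  finally show ?thesis
    using signed_pow_mult_self[of p a] by (simp add: algebra_simps)
qed

lemma continuous_signed_pow:
  assumes p: "p > 1"
  shows "isCont (signed_pow p) a"
proof (cases "a = 0")
  case True
  \<comment> \<open>The product defining \<open>signed_pow\<close> has a factor that is
    discontinuous at 0 when \<open>p \<le> 2\<close>, so the limit is taken for its absolute value,
    a positive power of \<open>\<bar>x\<bar>\<close>.\<close>
  have "((\<lambda>x::real. \<bar>x\<bar> powr (p - 1)) \<longlongrightarrow> 0) (at 0)"
  proof (rule tendsto_eq_rhs)
    show "((\<lambda>x::real. \<bar>x\<bar> powr (p - 1)) \<longlongrightarrow> \<bar>0\<bar> powr (p - 1)) (at 0)"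
      using p by (intro tendsto_powr' tendsto_intros) auto
  qed simp
  then have "(signed_pow p \<longlongrightarrow> 0) (at 0)"
    by (intro tendsto_rabs_zero_cancel[of "signed_pow p"]) (simp add: abs_signed_pow)
  then show ?thesis using True by (simp add: isCont_def)
next
  case False
  then show ?thesis unfolding signed_pow_def by (intro continuous_intros) auto
qed

lemma borel_measurable_signed_pow [measurable]:
  "f \<in> borel_measurable M \<Longrightarrow> (\<lambda>x. signed_pow p (f x)) \<in> borel_measurable M"
  unfolding signed_pow_def by measurable

lemma powr_pred_mult_le:
  fixes a b :: real
  assumes "p > 1" "a \<ge> 0" "b \<ge> 0"
  shows "a powr (p - 1) * b \<le> a powr p + b powr p"
proof -
  have "a powr (p - 1) * b \<le> max a b powr (p - 1) * max a b"
    using assms by (intro mult_mono powr_mono2) auto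
  also have "\<dots> = max a b powr p" using assms by (simp add: powr_pred_mult)
  also have "\<dots> \<le> a powr p + b powr p" by (auto simp: max_def)
  finally show ?thesis .
qed

lemma powr_add_le:
  fixes a b :: real
  assumes "p > 1" "a \<ge> 0" "b \<ge> 0"
  shows "(a + b) powr p \<le> 2 powr p * (a powr p + b powr p)"
proof -
  have "(a + b) powr p \<le> (2 * max a b) powr p"
    using assms by (intro powr_mono2) auto
  also have "\<dots> = 2 powr p * max a b powr p" using assms by (simp add: powr_mult)
  also have "\<dots> \<le> 2 powr p * (a powr p + b powr p)" by (auto simp: max_def)
  finally show ?thesis .
qed

lemma convex_on_abs_powr:
  assumes "p > 1"
  shows "convex_on UNIV (\<lambda>a::real. \<bar>a\<bar> powr p)"
proof (rule convex_on_subgradients)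
  show "\<bar>s\<bar> powr p + (p * signed_pow p s) * (t - s) \<le> \<bar>t\<bar> powr p" for s t
    using mult_left_mono[OF powr_subgradient[OF assms, of s t], of p] assms
    by (simp add: algebra_simps)
qed

section \<open>Proximal points and Moreau envelopes\<close>

lemma exists_proximal_point:
  assumes lsc: "lsc_enn j" and j0: "j 0 = 0" and c: "c > 0"
  shows "\<exists>r. \<forall>t. j r + ennreal (c * (s - r)\<^sup>2) \<le> j t + ennreal (c * (s - t)\<^sup>2)"
proof -
  define f where "f t = j t + ennreal (c * (s - t)\<^sup>2)" for t
  \<comment> \<open>Beyond \<open>2 * \<bar>s\<bar>\<close> the penalty alone is at least its value
    at 0, where \<open>j\<close> vanishes, so the minimization may be confined to this compact
    interval.\<close>
  define I where "I = (INF t\<in>{-2*\<bar>s\<bar>..2*\<bar>s\<bar>}. f t)"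
  obtain x where x: "\<And>n. x n \<in> f ` {-2*\<bar>s\<bar>..2*\<bar>s\<bar>}" "x \<longlonglongrightarrow> I"
    using Inf_as_limit[of "f ` {-2*\<bar>s\<bar>..2*\<bar>s\<bar>}"] unfolding I_def by auto
  have "\<forall>n. \<exists>r. r \<in> {-2*\<bar>s\<bar>..2*\<bar>s\<bar>} \<and> x n = f r"
    using x(1) by blast
  then obtain r where r1: "\<And>n. r n \<in> {-2*\<bar>s\<bar>..2*\<bar>s\<bar>}" and xr: "\<And>n. x n = f (r n)"
    by metis
  have r2: "(\<lambda>n. f (r n)) \<longlonglongrightarrow> I"
    using x(2) by (simp add: xr[symmetric])
  have "compact {-2*\<bar>s\<bar>..2*\<bar>s\<bar>}" by simp
  then obtain l h where l: "l \<in> {-2*\<bar>s\<bar>..2*\<bar>s\<bar>}" and h: "strict_mono h" "(r \<circ> h) \<longlonglongrightarrow> l"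
    using r1 unfolding compact_def by metis
  have I0: "I \<le> f 0"
    unfolding I_def by (rule INF_lower) simp
  have lim: "(\<lambda>n. f (r (h n))) \<longlonglongrightarrow> I"
    using LIMSEQ_subseq_LIMSEQ[OF r2 h(1)] by (simp add: o_def)
  have sq: "(\<lambda>n. ennreal (c * (s - r (h n))\<^sup>2)) \<longlonglongrightarrow> ennreal (c * (s - l)\<^sup>2)"
    using h(2) by (intro tendsto_intros) (simp add: o_def)
  have "j l \<le> liminf (\<lambda>n. j (r (h n)))"
    using lsc h(2) unfolding lsc_enn_def by (auto simp: o_def)
  also have "\<dots> = liminf (\<lambda>n. f (r (h n)) - ennreal (c * (s - r (h n))\<^sup>2))"
    by (simp add: f_def)
  also have "\<dots> = I - ennreal (c * (s - l)\<^sup>2)"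
    using I0 by (intro lim_imp_Liminf tendsto_diff_ennreal lim sq) (auto simp: f_def j0 top_unique)
  finally have "f l \<le> I - ennreal (c * (s - l)\<^sup>2) + ennreal (c * (s - l)\<^sup>2)"
    by (simp add: f_def add_right_mono)
  \<comment> \<open>Subtraction in \<open>ennreal\<close> is truncated; this inequality is what
    allows the penalty to be added back so that the right-hand side becomes
    \<open>I\<close>.\<close>
  moreover have "ennreal (c * (s - l)\<^sup>2) \<le> I"
    by (rule LIMSEQ_le[OF sq lim]) (auto simp: f_def)
  ultimately have fl: "f l \<le> I"
    by (simp add: diff_add_cancel_ennreal)
  have "f l \<le> f t" for t
  proof (cases "t \<in> {-2*\<bar>s\<bar>..2*\<bar>s\<bar>}")
    case True
    then show ?thesis using fl unfolding I_def by (meson INF_lower order_trans)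
  next
    case False
    then have "\<bar>t\<bar> > 2 * \<bar>s\<bar>" by auto
    then have "\<bar>s\<bar> \<le> \<bar>s - t\<bar>" by arith
    then have "s\<^sup>2 \<le> (s - t)\<^sup>2" by (rule abs_le_square_iff[THEN iffD1])
    have "f l \<le> f 0"
      using fl I0 by (rule order_trans)
    also have "f 0 = ennreal (c * s\<^sup>2)" by (simp add: f_def j0)
    also have "\<dots> \<le> ennreal (c * (s - t)\<^sup>2)"
      using \<open>s\<^sup>2 \<le> (s - t)\<^sup>2\<close> c by (intro ennreal_leI) auto
    also have "\<dots> \<le> f t" by (simp add: f_def)
    finally show ?thesis .
  qed
  then show ?thesis unfolding f_def by blast
qed

text \<open>Comparing the minimizer \<open>r\<close> with the points
  \<open>(1 - h) * r + h * t\<close> and dividing by \<open>h\<close> leaves an error of order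
  \<open>h\<close>; in the limit \<open>2 * c * (s - r)\<close> becomes a slope of \<open>j\<close>
  at \<open>r\<close>.\<close>

lemma proximal_point_subgradient:
  assumes conv: "convex_enn j" and c: "c > 0"
    and min: "\<And>t. j r + ennreal (c * (s - r)\<^sup>2) \<le> j t + ennreal (c * (s - t)\<^sup>2)"
    and fin: "j r < \<infinity>" "j t < \<infinity>"
  shows "enn2real (j r) + 2 * c * (s - r) * (t - r) \<le> enn2real (j t)"
proof -
  define a b where "a = enn2real (j r)" and "b = enn2real (j t)"
  have ab: "j r = ennreal a" "j t = ennreal b" "a \<ge> 0" "b \<ge> 0"
    using fin by (auto simp: a_def b_def)
  have ineq: "a + 2 * c * (s - r) * (t - r) - h * (c * (t - r)\<^sup>2) \<le> b" if h: "0 < h" "h \<le> 1" for h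
  proof -
    let ?z = "(1 - h) * r + h * t"
    have "ennreal (a + c * (s - r)\<^sup>2) = j r + ennreal (c * (s - r)\<^sup>2)"
      using ab c by (simp add: ennreal_plus)
    also have "\<dots> \<le> j ?z + ennreal (c * (s - ?z)\<^sup>2)" by (rule min)
    also have "\<dots> \<le> (ennreal (1 - h) * j r + ennreal h * j t) + ennreal (c * (s - ?z)\<^sup>2)"
      using conv h unfolding convex_enn_def by (intro add_right_mono) auto
    also have "\<dots> = ennreal ((1 - h) * a + h * b + c * (s - ?z)\<^sup>2)"
      using ab h c by (simp add: ennreal_plus ennreal_mult)
    finally have "a + c * (s - r)\<^sup>2 \<le> (1 - h) * a + h * b + c * (s - ?z)\<^sup>2"
      using ab h c by (subst (asm) ennreal_le_iff) (auto intro!: add_nonneg_nonneg)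
    moreover have "(s - ?z)\<^sup>2 = (s - r)\<^sup>2 - 2 * h * (s - r) * (t - r) + h\<^sup>2 * (t - r)\<^sup>2"
      by (simp add: power2_eq_square algebra_simps)
    ultimately have "h * (a + 2 * c * (s - r) * (t - r) - h * (c * (t - r)\<^sup>2)) \<le> h * b"
      by (simp add: algebra_simps power2_eq_square)
    then show ?thesis using h by simp
  qed
  have "((\<lambda>h. a + 2 * c * (s - r) * (t - r) - h * (c * (t - r)\<^sup>2)) \<longlongrightarrow>
      a + 2 * c * (s - r) * (t - r) - 0 * (c * (t - r)\<^sup>2)) (at_right 0)"
    by (intro tendsto_intros)
  moreover have "\<forall>\<^sub>F h in at_right 0. a + 2 * c * (s - r) * (t - r) - h * (c * (t - r)\<^sup>2) \<le> b"
    unfolding eventually_at_right_field using ineq by (intro exI[of _ 1]) auto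
  ultimately have "a + 2 * c * (s - r) * (t - r) - 0 * (c * (t - r)\<^sup>2) \<le> b"
    by (intro tendsto_upperbound[of _ _ "at_right 0"]) auto
  then show ?thesis by (simp add: a_def b_def)
qed

text \<open>The witnesses are the Moreau envelopes \<open>e n s\<close>, the minimum over \<open>r\<close> of
  \<open>j r + (n + 1) * (s - r)\<^sup>2\<close>, and \<open>R n s = s - r\<close> at the minimizer \<open>r\<close>, so that the derivative
  of \<open>e n\<close> is \<open>2 * (n + 1) * R n\<close>.\<close>

lemma moreau_approximation:
  assumes conv: "convex_enn j" and lsc: "lsc_enn j" and j0: "j 0 = 0"
  obtains e R :: "nat \<Rightarrow> real \<Rightarrow> real"
  where "\<And>n s. 0 \<le> e n s" "\<And>n s. ennreal (e n s) \<le> j s" "\<And>n s. e n s \<le> real (Suc n) * s\<^sup>2"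
    "\<And>n s t. e n s + 2 * real (Suc n) * R n s * (t - s) \<le> e n t"
    "\<And>n. R n 0 = 0"
    "\<And>n s t. 0 \<le> R n s - R n t \<and> R n s - R n t \<le> s - t \<or> s - t \<le> R n s - R n t \<and> R n s - R n t \<le> 0"
    "\<And>s. j s \<le> liminf (\<lambda>n. ennreal (e n s))"
proof -
  have "\<forall>n s. \<exists>r. \<forall>t. j r + ennreal (real (Suc n) * (s - r)\<^sup>2) \<le> j t + ennreal (real (Suc n) * (s - t)\<^sup>2)"
    using exists_proximal_point[OF lsc j0] by simp
  then obtain J where J: "\<And>n s t. j (J n s) + ennreal (real (Suc n) * (s - J n s)\<^sup>2)
      \<le> j t + ennreal (real (Suc n) * (s - t)\<^sup>2)" by metis
  define R where "R n s = s - J n s" for n s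
  define e where "e n s = enn2real (j (J n s)) + real (Suc n) * (s - J n s)\<^sup>2" for n s
  have fin: "j (J n s) < \<infinity>" for n s
  proof -
    have "j (J n s) \<le> j (J n s) + ennreal (real (Suc n) * (s - J n s)\<^sup>2)" by simp
    also have "\<dots> \<le> j 0 + ennreal (real (Suc n) * (s - 0)\<^sup>2)" by (rule J)
    also have "\<dots> < \<infinity>" by (simp add: j0)
    finally show ?thesis .
  qed
  have e_enn: "ennreal (e n s) = j (J n s) + ennreal (real (Suc n) * (s - J n s)\<^sup>2)" for n s
    using fin[of n s] by (simp add: e_def ennreal_plus)
  have sub: "enn2real (j (J n s)) + 2 * real (Suc n) * R n s * (J n t - J n s) \<le> enn2real (j (J n t))" for n s t
    unfolding R_def by (rule proximal_point_subgradient[OF conv _ J fin fin]) simp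
  have e_nonneg: "0 \<le> e n s" for n s by (simp add: e_def)
  have e_le: "ennreal (e n s) \<le> j s" for n s
    using J[of n s s] by (simp add: e_enn)
  have e_sq: "e n s \<le> real (Suc n) * s\<^sup>2" for n s
  proof -
    have "ennreal (e n s) \<le> ennreal (real (Suc n) * s\<^sup>2)"
      using J[of n s 0] by (simp add: e_enn j0)
    then show ?thesis by (subst (asm) ennreal_le_iff) auto
  qed
  \<comment> \<open>Since \<open>s = J n s + R n s\<close>, the gap is the subgradient gap of
    \<open>j\<close> between the two proximal points plus a nonnegative multiple of a
    square.\<close>
  have e_sub: "e n s + 2 * real (Suc n) * R n s * (t - s) \<le> e n t" for n s t
  proof -
    have "e n t - e n s - 2 * real (Suc n) * R n s * (t - s)
       = (enn2real (j (J n t)) - enn2real (j (J n s)) - 2 * real (Suc n) * R n s * (J n t - J n s))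
         + real (Suc n) * (R n t - R n s)\<^sup>2"
      unfolding e_def R_def by (simp add: algebra_simps power2_eq_square)
    also have "\<dots> \<ge> 0" using sub[of n s t] by (intro add_nonneg_nonneg) auto
    finally show ?thesis by simp
  qed
  have R0: "R n 0 = 0" for n
  proof -
    have "j (J n 0) + ennreal (real (Suc n) * (J n 0)\<^sup>2) = 0"
      using J[of n 0 0] by (simp add: j0)
    then show ?thesis by (simp add: R_def ennreal_eq_0_iff mult_le_0_iff)
  qed
  \<comment> \<open>The slopes of \<open>j\<close> at the two proximal points are monotone. As
    \<open>J n\<close> is the identity minus \<open>R n\<close>, this says that the increment of
    \<open>R n\<close> has the sign of \<open>s - t\<close> and is no larger in modulus.\<close>
  have R_between: "0 \<le> R n s - R n t \<and> R n s - R n t \<le> s - t \<or> s - t \<le> R n s - R n t \<and> R n s - R n t \<le> 0" for n s t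
  proof -
    have "2 * real (Suc n) * ((R n t - R n s) * (J n t - J n s)) \<ge> 0"
      using sub[of n s t] sub[of n t s] by (simp add: algebra_simps)
    then have "(R n t - R n s) * (J n t - J n s) \<ge> 0"
      by (simp add: zero_le_mult_iff)
    then have "(R n s - R n t) * ((s - t) - (R n s - R n t)) \<ge> 0"
      by (simp add: R_def algebra_simps)
    then show ?thesis by (auto simp: zero_le_mult_iff)
  qed
  have e_inc: "ennreal (e n s) \<le> ennreal (e (Suc n) s)" for n s
  proof -
    have "ennreal (e n s) \<le> j (J (Suc n) s) + ennreal (real (Suc n) * (s - J (Suc n) s)\<^sup>2)"
      using J by (simp add: e_enn)
    also have "\<dots> \<le> j (J (Suc n) s) + ennreal (real (Suc (Suc n)) * (s - J (Suc n) s)\<^sup>2)"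
      by (intro add_left_mono ennreal_leI mult_right_mono) auto
    finally show ?thesis by (simp add: e_enn)
  qed
  have lim: "j s \<le> liminf (\<lambda>n. ennreal (e n s))" for s
  proof -
    have "incseq (\<lambda>n. ennreal (e n s))" using e_inc by (rule incseq_SucI)
    then have lE: "liminf (\<lambda>n. ennreal (e n s)) = (SUP n. ennreal (e n s))"
      using LIMSEQ_SUP lim_imp_Liminf by (metis trivial_limit_sequentially)
    \<comment> \<open>If the envelopes stay below some \<open>L\<close>, the growing penalty factor
      forces \<open>J n s\<close> to converge to \<open>s\<close>, and lower semicontinuity of
      \<open>j\<close> applies; if they are unbounded, the right-hand side is infinite.\<close>
    show ?thesis
    proof (cases "(SUP n. ennreal (e n s)) = \<infinity>")
      case True
      then show ?thesis unfolding lE by (simp only: infinity_ennreal_def top_greatest)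
    next
      case False
      then obtain L where L: "(SUP n. ennreal (e n s)) = ennreal L" "L \<ge> 0"
        by (cases "SUP n. ennreal (e n s)") auto
      have eL: "e n s \<le> L" for n
        using SUP_upper[of n UNIV "\<lambda>n. ennreal (e n s)"] L by simp
      have sq: "(s - J n s)\<^sup>2 \<le> L / real (Suc n)" for n
      proof -
        have "real (Suc n) * (s - J n s)\<^sup>2 \<le> L" using eL[of n] by (simp add: e_def) (smt (verit) enn2real_nonneg)
        then show ?thesis by (simp add: field_simps)
      qed
      have "(\<lambda>n. L / real (Suc n)) \<longlonglongrightarrow> 0"
        using tendsto_mult_right_zero[OF LIMSEQ_inverse_real_of_nat, of L] by (simp add: divide_inverse)
      then have "(\<lambda>n. (s - J n s)\<^sup>2) \<longlonglongrightarrow> 0"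
        by (rule Lim_null_comparison[rotated]) (use sq in auto)
      then have "(\<lambda>n. s - J n s) \<longlonglongrightarrow> 0" by (simp add: power_tendsto_0_iff)
      then have "(\<lambda>n. s - (s - J n s)) \<longlonglongrightarrow> s - 0" by (intro tendsto_intros)
      then have "(\<lambda>n. J n s) \<longlonglongrightarrow> s" by simp
      then have "j s \<le> liminf (\<lambda>n. j (J n s))" using lsc by (simp add: lsc_enn_def)
      also have "\<dots> \<le> liminf (\<lambda>n. ennreal (e n s))"
        by (intro Liminf_mono always_eventually allI) (simp add: e_enn)
      finally show ?thesis .
    qed
  qed
  show ?thesis
    by (rule that[of e R]) (fact e_nonneg e_le e_sq e_sub R0 R_between lim)+
qed

section \<open>Square integrable functions and subdifferentials\<close>

lemma L2_measurable: "u \<in> L2 nu \<Longrightarrow> u \<in> borel_measurable nu"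
  and L2_integrable: "u \<in> L2 nu \<Longrightarrow> integrable nu (\<lambda>x. (u x)\<^sup>2)"
  by (auto simp: L2_def)

lemma L2_bound:
  assumes g: "g \<in> L2 nu" and f: "f \<in> borel_measurable nu" and le: "\<And>x. \<bar>f x\<bar> \<le> \<bar>g x\<bar>"
  shows "f \<in> L2 nu"
proof -
  have "integrable nu (\<lambda>x. (f x)\<^sup>2)"
  proof (rule Bochner_Integration.integrable_bound[OF L2_integrable[OF g]])
    show "AE x in nu. norm ((f x)\<^sup>2) \<le> norm ((g x)\<^sup>2)"
      using le by (auto simp: abs_le_square_iff)
  qed (use f in measurable)
  then show ?thesis using f by (simp add: L2_def)
qed

lemma L2_cmult: "u \<in> L2 nu \<Longrightarrow> (\<lambda>x. c * u x) \<in> L2 nu"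
  by (auto simp: L2_def power_mult_distrib)

lemma L2_add:
  assumes u: "u \<in> L2 nu" and w: "w \<in> L2 nu"
  shows "(\<lambda>x. u x + w x) \<in> L2 nu"
proof -
  have [measurable]: "u \<in> borel_measurable nu" "w \<in> borel_measurable nu"
    using assms by (auto simp: L2_def)
  have "integrable nu (\<lambda>x. (u x + w x)\<^sup>2)"
  proof (rule Bochner_Integration.integrable_bound)
    show "integrable nu (\<lambda>x. 2 * (u x)\<^sup>2 + 2 * (w x)\<^sup>2)"
      using assms by (auto simp: L2_def)
    have "(u x + w x)\<^sup>2 \<le> 2 * (u x)\<^sup>2 + 2 * (w x)\<^sup>2" for x
      using zero_le_power2[of "u x - w x"] by (simp add: power2_eq_square algebra_simps)
    then show "AE x in nu. norm ((u x + w x)\<^sup>2) \<le> norm (2 * (u x)\<^sup>2 + 2 * (w x)\<^sup>2)"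
      by (auto simp: abs_of_nonneg)
  qed measurable
  then show ?thesis by (simp add: L2_def)
qed

lemma L2_uminus: "u \<in> L2 nu \<Longrightarrow> (\<lambda>x. - u x) \<in> L2 nu"
  using L2_cmult[of u nu "-1"] by simp

lemma L2_diff: "u \<in> L2 nu \<Longrightarrow> w \<in> L2 nu \<Longrightarrow> (\<lambda>x. u x - w x) \<in> L2 nu"
  using L2_add[of u nu "\<lambda>x. - w x"] L2_uminus[of w nu] by simp

lemma L2_mult_integrable:
  assumes u: "u \<in> L2 nu" and w: "w \<in> L2 nu"
  shows "integrable nu (\<lambda>x. u x * w x)"
proof (rule Bochner_Integration.integrable_bound)
  show "integrable nu (\<lambda>x. (u x)\<^sup>2 + (w x)\<^sup>2)"
    using assms by (auto simp: L2_def)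
  show "(\<lambda>x. u x * w x) \<in> borel_measurable nu"
    using assms by (auto simp: L2_def)
  have "\<bar>u x * w x\<bar> \<le> (u x)\<^sup>2 + (w x)\<^sup>2" for x
  proof -
    have "0 \<le> (\<bar>u x\<bar> - \<bar>w x\<bar>)\<^sup>2" by simp
    then have "2 * (\<bar>u x\<bar> * \<bar>w x\<bar>) \<le> (u x)\<^sup>2 + (w x)\<^sup>2"
      by (simp add: power2_diff)
    moreover have "0 \<le> \<bar>u x\<bar> * \<bar>w x\<bar>" by simp
    ultimately show ?thesis unfolding abs_mult by linarith
  qed
  then show "AE x in nu. norm (u x * w x) \<le> norm ((u x)\<^sup>2 + (w x)\<^sup>2)"
    by (auto simp: abs_of_nonneg)
qed

lemma L2_indicator:
  assumes "S \<in> sets nu" "emeasure nu S < \<infinity>"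
  shows "(indicator S :: 'a \<Rightarrow> real) \<in> L2 nu"
proof -
  have "(\<lambda>x. (indicator S x)\<^sup>2 :: real) = indicator S"
    by (auto simp: indicator_def)
  then show ?thesis using assms by (simp add: L2_def)
qed

lemma
  fixes f :: "'a \<Rightarrow> real"
  assumes "f \<in> borel_measurable M" "\<And>x. 0 \<le> f x" "(\<integral>\<^sup>+ x. ennreal (f x) \<partial>M) < \<infinity>"
  shows integrable_finite_nn_integral: "integrable M f"
    and enn2real_nn_integral: "enn2real (\<integral>\<^sup>+ x. ennreal (f x) \<partial>M) = (\<integral>x. f x \<partial>M)"
proof -
  show "integrable M f" using assms by (intro integrableI_nonneg) auto
  then show "enn2real (\<integral>\<^sup>+ x. ennreal (f x) \<partial>M) = (\<integral>x. f x \<partial>M)"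
    using assms by (simp add: nn_integral_eq_integral integral_nonneg_AE)
qed

text \<open>A competitor of infinite energy imposes no condition, so the inequality between extended
  reals reduces to a real one on the effective domain.\<close>

lemma subdiff_iff:
  "(u, v) \<in> subdiff nu F \<longleftrightarrow> u \<in> L2 nu \<and> v \<in> L2 nu \<and> F u < \<infinity> \<and>
    (\<forall>w\<in>L2 nu. F w < \<infinity> \<longrightarrow> enn2real (F u) + (\<integral>x. v x * (w x - u x) \<partial>nu) \<le> enn2real (F w))"
proof -
  have "enn2ereal (F u) + ereal c \<le> enn2ereal (F w) \<longleftrightarrow>
      (F w < \<infinity> \<longrightarrow> enn2real (F u) + c \<le> enn2real (F w))" if "F u < \<infinity>" for w c
    using that by (cases "F u"; cases "F w") auto
  then show ?thesis unfolding subdiff_def by (auto simp: less_top)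
qed

section \<open>Truncation, and bounds tested on sets of finite measure\<close>

definition clip :: "real \<Rightarrow> real \<Rightarrow> real" where
  "clip k x = max (- k) (min k x)"

text \<open>Being 1-Lipschitz, truncation never increases the modulus of a gradient; this provides
  the dominating functions whenever a direction in L2 is approximated by bounded ones.\<close>

lemma abs_clip_le: "k \<ge> 0 \<Longrightarrow> \<bar>clip k x\<bar> \<le> k"
  and abs_clip_le_self: "k \<ge> 0 \<Longrightarrow> \<bar>clip k x\<bar> \<le> \<bar>x\<bar>"
  and abs_clip_diff_le: "k \<ge> 0 \<Longrightarrow> \<bar>clip k x - clip k y\<bar> \<le> \<bar>x - y\<bar>"
  by (auto simp: clip_def max_def min_def)

lemma borel_measurable_clip [measurable]:
  "f \<in> borel_measurable M \<Longrightarrow> (\<lambda>x. clip k (f x)) \<in> borel_measurable M"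
  unfolding clip_def by (intro borel_measurable_max borel_measurable_min) auto

lemma tendsto_clip: "(\<lambda>n. clip (real n) x) \<longlonglongrightarrow> x"
proof (rule tendsto_eventually)
  show "\<forall>\<^sub>F n in sequentially. clip (real n) x = x"
    using eventually_ge_at_top[of "nat \<lceil>\<bar>x\<bar>\<rceil>"]
    by eventually_elim (auto simp: clip_def)
qed

lemma L2_clip: "u \<in> L2 nu \<Longrightarrow> k \<ge> 0 \<Longrightarrow> (\<lambda>x. clip k (u x)) \<in> L2 nu"
  by (rule L2_bound) (auto simp: L2_def abs_clip_le_self)

lemma tendsto_integral_clip:
  assumes "integrable nu (\<lambda>x. v x * u x)" "v \<in> borel_measurable nu" "u \<in> borel_measurable nu"
  shows "(\<lambda>n. \<integral>x. v x * clip (real n) (u x) \<partial>nu) \<longlonglongrightarrow> (\<integral>x. v x * u x \<partial>nu)"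
proof (rule integral_dominated_convergence)
  show "integrable nu (\<lambda>x. \<bar>v x * u x\<bar>)" using assms(1) by simp
  show "AE x in nu. (\<lambda>n. v x * clip (real n) (u x)) \<longlonglongrightarrow> v x * u x"
    by (intro AE_I2 tendsto_intros tendsto_clip)
  show "AE x in nu. norm (v x * clip (real n) (u x)) \<le> \<bar>v x * u x\<bar>" for n
    by (auto simp: abs_mult intro!: mult_left_mono abs_clip_le_self)
qed (use assms in measurable)

text \<open>Tested on the part of \<open>{W > c}\<close> inside a piece \<open>D n\<close> of finite
  measure, where \<open>W - c\<close> is positive but has integral at most 0. Sets of finite measure
  are the ones whose indicators are directions in L2.\<close>

lemma (in sigma_finite_measure) AE_le_of_set_integral_le:
  fixes W :: "'a \<Rightarrow> real"
  assumes [measurable]: "W \<in> borel_measurable M"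
    and int: "\<And>S. S \<in> sets M \<Longrightarrow> emeasure M S < \<infinity> \<Longrightarrow> integrable M (\<lambda>x. W x * indicator S x)"
    and le: "\<And>S. S \<in> sets M \<Longrightarrow> emeasure M S < \<infinity> \<Longrightarrow> (\<integral>x. W x * indicator S x \<partial>M) \<le> c * measure M S"
  shows "AE x in M. W x \<le> c"
proof -
  obtain D :: "nat \<Rightarrow> 'a set" where D: "range D \<subseteq> sets M" "(\<Union>i. D i) = space M" "\<And>i. emeasure M (D i) \<noteq> \<infinity>"
    using sigma_finite by blast
  have "AE x in M. x \<in> D n \<longrightarrow> W x \<le> c" for n
  proof -
    have [measurable]: "D n \<in> sets M" using D by auto
    define S where "S = {x \<in> D n. W x > c}"
    have S_eq: "S = {x \<in> space M. x \<in> D n \<and> W x > c}"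
      using D(2) by (auto simp: S_def)
    have S[measurable]: "S \<in> sets M" unfolding S_eq by measurable
    have "emeasure M S \<le> emeasure M (D n)" by (rule emeasure_mono) (auto simp: S_def)
    then have fS: "emeasure M S < \<infinity>" using D(3)[of n] by (simp add: less_top order_le_less_trans)
    have iS: "integrable M (indicator S :: 'a \<Rightarrow> real)" using fS by simp
    have i1: "integrable M (\<lambda>x. W x * indicator S x - c * indicator S x)"
      by (rule Bochner_Integration.integrable_diff[OF int[OF S fS]]) (use iS in simp)
    have nn: "0 \<le> W x * indicator S x - c * indicator S x" for x
      by (auto simp: S_def split: split_indicator)
    have "(\<integral>x. W x * indicator S x - c * indicator S x \<partial>M)
        = (\<integral>x. W x * indicator S x \<partial>M) - c * measure M S"
      using int[OF S fS] iS sets.sets_into_space[OF S]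
      by (subst Bochner_Integration.integral_diff) (auto simp: Int_absorb2)
    also have "\<dots> \<le> 0" using le[OF S fS] by simp
    finally have "(\<integral>x. W x * indicator S x - c * indicator S x \<partial>M) = 0"
      using nn by (intro antisym integral_nonneg_AE) auto
    then have "AE x in M. W x * indicator S x - c * indicator S x = 0"
      using integral_nonneg_eq_0_iff_AE[OF i1] nn by auto
    then show ?thesis
      by eventually_elim (auto simp: S_def indicator_def split: if_splits)
  qed
  then have "AE x in M. \<forall>n. x \<in> D n \<longrightarrow> W x \<le> c" by (subst AE_all_countable) blast
  then show ?thesis
    using AE_space by eventually_elim (use D(2) in auto)
qed

lemma Kker_nonneg: "0 \<le> Kker A x y"
  and Kker_le_1: "Kker A x y \<le> 1"
  and Kker_commute: "Kker A y x = Kker A x y"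
  by (auto simp: Kker_def indicator_def)

lemma grad_commute: "grad u y x = - grad u x y"
  by (simp add: grad_def)

section \<open>Integration by parts and square integrable fields\<close>

context reversible_walk
begin

lemma borel_measurable_grad [measurable]:
  assumes [measurable]: "u \<in> borel_measurable nu"
  shows "(\<lambda>z. grad u (fst z) (snd z)) \<in> borel_measurable (nu \<Otimes>\<^sub>M nu)"
  unfolding grad_def by measurable

lemma borel_measurable_Kker:
  assumes "{(x, y). x \<in> space nu \<and> y \<in> A x} \<in> sets (nu \<Otimes>\<^sub>M nu)"
  shows "(\<lambda>z. Kker A (fst z) (snd z)) \<in> borel_measurable (nu \<Otimes>\<^sub>M nu)"
proof -
  define S where "S = {(x, y). x \<in> space nu \<and> y \<in> A x}"
  have [measurable]: "S \<in> sets (nu \<Otimes>\<^sub>M nu)" using assms by (simp add: S_def)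
  have "(\<lambda>z. (indicator S z + indicator S (snd z, fst z)) / 2 :: real) \<in> borel_measurable (nu \<Otimes>\<^sub>M nu)"
    by measurable
  then show ?thesis
    by (rule measurable_cong[THEN iffD1, rotated])
       (auto simp: Kker_def S_def space_pair_measure indicator_def)
qed

lemma measurable_nu_m_iff: "borel_measurable (nu_m nu m) = borel_measurable (nu \<Otimes>\<^sub>M nu)"
  by (rule measurable_cong_sets[OF sets_nu_m refl])

text \<open>Swapping the coordinates turns \<open>G z * f (snd z)\<close> into
  \<open>- (G z * f (fst z))\<close>. Hence integrability of one product gives that of the other,
  and the two halves of the gradient contribute equally, which cancels the factor 1/2.\<close>

lemma
  fixes G :: "'a \<times> 'a \<Rightarrow> real"
  assumes G: "G \<in> borel_measurable (nu \<Otimes>\<^sub>M nu)" and anti: "\<And>x y. G (y, x) = - G (x, y)"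
    and i: "integrable (nu_m nu m) (\<lambda>z. G z * f (fst z))" and f: "f \<in> borel_measurable nu"
  shows parts_integrable: "integrable (nu_m nu m) (\<lambda>z. G z * grad f (fst z) (snd z))"
    and parts_integrable_div: "integrable nu (\<lambda>x. (\<integral>y. G (x, y) \<partial>(m x)) * f x)"
    and parts: "(\<integral>z. G z * grad f (fst z) (snd z) / 2 \<partial>(nu_m nu m))
      = - (\<integral>x. (\<integral>y. G (x, y) \<partial>(m x)) * f x \<partial>nu)"
proof -
  have sw: "G z * f (snd z) = - (G (snd z, fst z) * f (fst (snd z, fst z)))" for z
    using anti[of "fst z" "snd z"] by simp
  have i2: "integrable (nu_m nu m) (\<lambda>z. G z * f (snd z))"
    unfolding sw using integrable_nu_m_swap[OF i] by simp
  have gr: "G z * grad f (fst z) (snd z) = G z * f (snd z) - G z * f (fst z)" for z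
    by (simp add: grad_def algebra_simps)
  show "integrable (nu_m nu m) (\<lambda>z. G z * grad f (fst z) (snd z))"
    unfolding gr using i i2 by simp
  have m: "(\<lambda>z. G z * f (fst z)) \<in> borel_measurable (nu \<Otimes>\<^sub>M nu)"
    using G f by measurable
  have "(\<integral>z. G z * f (snd z) \<partial>(nu_m nu m)) = - (\<integral>z. G z * f (fst z) \<partial>(nu_m nu m))"
    unfolding sw using integral_nu_m_swap[OF m] by simp
  then have "(\<integral>z. G z * grad f (fst z) (snd z) / 2 \<partial>(nu_m nu m)) = - (\<integral>z. G z * f (fst z) \<partial>(nu_m nu m))"
    unfolding gr using i i2 by simp
  also have "\<dots> = - (\<integral>x. (\<integral>y. G (x, y) \<partial>(m x)) * f x \<partial>nu)"
    by (simp add: integral_nu_m_Fubini[OF i])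
  finally show "(\<integral>z. G z * grad f (fst z) (snd z) / 2 \<partial>(nu_m nu m))
      = - (\<integral>x. (\<integral>y. G (x, y) \<partial>(m x)) * f x \<partial>nu)" .
  show "integrable nu (\<lambda>x. (\<integral>y. G (x, y) \<partial>(m x)) * f x)"
    using integrable_nu_m_Fubini[OF i] by simp
qed

text \<open>Each \<open>m x\<close> is a probability measure, so nonnegativity of the variance
  bounds the square of the mean by the mean of the square; the latter is integrable in
  \<open>x\<close> by Fubini.\<close>

lemma
  fixes G :: "'a \<times> 'a \<Rightarrow> real"
  assumes G: "G \<in> borel_measurable (nu \<Otimes>\<^sub>M nu)" and i: "integrable (nu_m nu m) (\<lambda>z. (G z)\<^sup>2)"
  shows L2_kernel_integral: "(\<lambda>x. \<integral>y. G (x, y) \<partial>(m x)) \<in> L2 nu"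
    and AE_integrable_of_square: "AE x in nu. integrable (m x) (\<lambda>y. G (x, y))"
proof -
  have AEs: "AE x in nu. integrable (m x) (\<lambda>y. G (x, y)) \<and>
      (\<integral>y. G (x, y) \<partial>(m x))\<^sup>2 \<le> (\<integral>y. (G (x, y))\<^sup>2 \<partial>(m x))"
    using AE_nu_m_section[OF i] AE_space
  proof eventually_elim
    case (elim x)
    then have P: "prob_space (m x)" using prob_space_m by blast
    have G': "(\<lambda>y. G (x, y)) \<in> borel_measurable (m x)" using elim by (intro measurable_section[OF G])
    have "integrable (m x) (\<lambda>y. G (x, y))"
      by (rule finite_measure.square_integrable_imp_integrable[OF prob_space.finite_measure[OF P] G'])
         (use elim in simp)
    then show ?case
      using elim prob_space.variance_eq[OF P, of "\<lambda>y. G (x, y)"]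
        prob_space.variance_positive[OF P, of "\<lambda>y. G (x, y)"] by simp
  qed
  then show "AE x in nu. integrable (m x) (\<lambda>y. G (x, y))" by auto
  have V: "(\<lambda>x. \<integral>y. G (x, y) \<partial>(m x)) \<in> borel_measurable nu"
    by (rule measurable_kernel_integral[OF G])
  have "integrable nu (\<lambda>x. (\<integral>y. G (x, y) \<partial>(m x))\<^sup>2)"
  proof (rule Bochner_Integration.integrable_bound[OF integrable_nu_m_Fubini[OF i]])
    show "AE x in nu. norm ((\<integral>y. G (x, y) \<partial>(m x))\<^sup>2) \<le> norm (\<integral>y. (G (x, y))\<^sup>2 \<partial>(m x))"
      using AEs by eventually_elim (auto simp: abs_of_nonneg)
  qed (use V in measurable)
  then show "(\<lambda>x. \<integral>y. G (x, y) \<partial>(m x)) \<in> L2 nu" using V by (simp add: L2_def)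
qed

lemma L2_nu_m_fst: "f \<in> L2 nu \<Longrightarrow> (\<lambda>z. f (fst z)) \<in> L2 (nu_m nu m)"
  using integrable_nu_m_fst[of "\<lambda>x. (f x)\<^sup>2"] by (auto simp: L2_def measurable_nu_m_iff)

lemma L2_nu_m_snd: "f \<in> L2 nu \<Longrightarrow> (\<lambda>z. f (snd z)) \<in> L2 (nu_m nu m)"
  using integrable_nu_m_snd[of "\<lambda>x. (f x)\<^sup>2"] by (auto simp: L2_def measurable_nu_m_iff)

lemma L2_nu_m_grad: "f \<in> L2 nu \<Longrightarrow> (\<lambda>z. grad f (fst z) (snd z)) \<in> L2 (nu_m nu m)"
  unfolding grad_def by (intro L2_diff L2_nu_m_fst L2_nu_m_snd)

end

section \<open>Complete accretivity of subdifferentials\<close>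

text \<open>Monotonicity and the Lipschitz constant 1 are encoded together: the increment of
  \<open>R\<close> lies between 0 and the increment of its argument, the form that
  \<open>convex_on_exchange\<close> consumes.\<close>

definition mono_contraction :: "(real \<Rightarrow> real) \<Rightarrow> bool" where
  "mono_contraction R \<longleftrightarrow> R 0 = 0 \<and>
     (\<forall>s t. 0 \<le> R s - R t \<and> R s - R t \<le> s - t \<or> s - t \<le> R s - R t \<and> R s - R t \<le> 0)"

lemma mono_contraction_measurable:
  assumes "mono_contraction R"
  shows "R \<in> borel_measurable borel"
proof (rule borel_measurable_mono)
  show "mono R"
    using assms unfolding mono_contraction_def mono_def by (smt (verit))
qed

lemma mono_contraction_abs_le: "mono_contraction R \<Longrightarrow> \<bar>R s\<bar> \<le> \<bar>s\<bar>"
  unfolding mono_contraction_def by (smt (verit))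

lemma L2_mono_contraction:
  assumes R: "mono_contraction R" and u: "u \<in> L2 nu"
  shows "(\<lambda>x. R (u x)) \<in> L2 nu"
proof (rule L2_bound[OF u])
  show "(\<lambda>x. R (u x)) \<in> borel_measurable nu"
    by (rule measurable_compose[OF L2_measurable[OF u] mono_contraction_measurable[OF R]])
qed (rule mono_contraction_abs_le[OF R])

text \<open>The subgradient at \<open>u1\<close> is tested with \<open>u1 - R (u1 - u2)\<close> and
  the one at \<open>u2\<close> with \<open>u2 + R (u1 - u2)\<close>. The exchange hypothesis keeps
  the energies of both competitors finite and eliminates all energies from the sum of the two
  inequalities.\<close>

lemma subdiff_mono_contraction:
  assumes 1: "(u1, v1) \<in> subdiff nu F" and 2: "(u2, v2) \<in> subdiff nu F" and R: "mono_contraction R"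
    and ex: "F (\<lambda>x. u1 x - R (u1 x - u2 x)) + F (\<lambda>x. u2 x + R (u1 x - u2 x)) \<le> F u1 + F u2"
  shows "0 \<le> (\<integral>x. (v1 x - v2 x) * R (u1 x - u2 x) \<partial>nu)"
proof -
  let ?w1 = "\<lambda>x. u1 x - R (u1 x - u2 x)" and ?w2 = "\<lambda>x. u2 x + R (u1 x - u2 x)"
  have L: "u1 \<in> L2 nu" "v1 \<in> L2 nu" "u2 \<in> L2 nu" "v2 \<in> L2 nu"
    and fin: "F u1 < \<infinity>" "F u2 < \<infinity>" using 1 2 unfolding subdiff_iff by blast+
  have RL: "(\<lambda>x. R (u1 x - u2 x)) \<in> L2 nu" by (rule L2_mono_contraction[OF R L2_diff[OF L(1,3)]])
  have "F ?w1 + F ?w2 < \<infinity>" by (rule order_le_less_trans[OF ex]) (use fin in simp)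
  then have fw: "F ?w1 < \<infinity>" "F ?w2 < \<infinity>" by auto
  have w: "?w1 \<in> L2 nu" "?w2 \<in> L2 nu" using L RL by (auto intro: L2_diff L2_add)
  have i1: "enn2real (F u1) + (\<integral>x. v1 x * (?w1 x - u1 x) \<partial>nu) \<le> enn2real (F ?w1)"
    using 1 w fw unfolding subdiff_iff by blast
  have i2: "enn2real (F u2) + (\<integral>x. v2 x * (?w2 x - u2 x) \<partial>nu) \<le> enn2real (F ?w2)"
    using 2 w fw unfolding subdiff_iff by blast
  have "enn2real (F ?w1) + enn2real (F ?w2) = enn2real (F ?w1 + F ?w2)"
    using fw by (simp add: enn2real_plus)
  also have "\<dots> \<le> enn2real (F u1 + F u2)"
    using ex fin by (intro enn2real_mono) auto
  also have "\<dots> = enn2real (F u1) + enn2real (F u2)"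
    using fin by (simp add: enn2real_plus)
  finally have "(\<integral>x. v1 x * (?w1 x - u1 x) \<partial>nu) + (\<integral>x. v2 x * (?w2 x - u2 x) \<partial>nu) \<le> 0"
    using i1 i2 by linarith
  then have "0 \<le> (\<integral>x. v1 x * R (u1 x - u2 x) \<partial>nu) - (\<integral>x. v2 x * R (u1 x - u2 x) \<partial>nu)"
    by simp
  also have "\<dots> = (\<integral>x. (v1 x - v2 x) * R (u1 x - u2 x) \<partial>nu)"
    using L2_mult_integrable[OF L(2) RL] L2_mult_integrable[OF L(4) RL]
    by (simp add: left_diff_distrib)
  finally show ?thesis .
qed

text \<open>The envelope \<open>e n\<close> has slope \<open>2 * real (Suc n) * R n (u x)\<close> at
  \<open>u x\<close>, so its supporting line, evaluated at \<open>u x + lam * v x\<close>, has a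
  linear term whose integral is nonnegative by \<open>acc\<close>. The quadratic bound on
  \<open>e n\<close> makes the integrals finite for L2 functions.\<close>

lemma nn_integral_convex_le_of_accretive:
  assumes u: "u \<in> L2 nu" and v: "v \<in> L2 nu" and lam: "lam > 0"
    and acc: "\<And>R. mono_contraction R \<Longrightarrow> 0 \<le> (\<integral>x. v x * R (u x) \<partial>nu)"
    and j: "convex_enn j" "lsc_enn j" "j 0 = 0"
  shows "(\<integral>\<^sup>+ x. j (u x) \<partial>nu) \<le> (\<integral>\<^sup>+ x. j (u x + lam * v x) \<partial>nu)"
proof -
  obtain e R :: "nat \<Rightarrow> real \<Rightarrow> real"
    where e: "\<And>n s. 0 \<le> e n s" "\<And>n s. ennreal (e n s) \<le> j s" "\<And>n s. e n s \<le> real (Suc n) * s\<^sup>2"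
    and sub: "\<And>n s t. e n s + 2 * real (Suc n) * R n s * (t - s) \<le> e n t"
    and R: "\<And>n. R n 0 = 0"
    "\<And>n s t. 0 \<le> R n s - R n t \<and> R n s - R n t \<le> s - t \<or> s - t \<le> R n s - R n t \<and> R n s - R n t \<le> 0"
    and lim: "\<And>s. j s \<le> liminf (\<lambda>n. ennreal (e n s))"
    using moreau_approximation[OF j] by blast
  have mc: "mono_contraction (R n)" for n
    using R unfolding mono_contraction_def by blast
  have em: "e n \<in> borel_measurable borel" for n
    using convex_on_continuous[OF open_UNIV convex_on_subgradients[OF sub]]
    by (rule borel_measurable_continuous_onI)
  have int_e: "integrable nu (\<lambda>x. e n (w x))" if w: "w \<in> L2 nu" for n w
  proof (rule Bochner_Integration.integrable_bound)
    show "integrable nu (\<lambda>x. real (Suc n) * (w x)\<^sup>2)" using L2_integrable[OF w] by simp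
    show "(\<lambda>x. e n (w x)) \<in> borel_measurable nu"
      by (rule measurable_compose[OF L2_measurable[OF w] em])
    show "AE x in nu. norm (e n (w x)) \<le> norm (real (Suc n) * (w x)\<^sup>2)"
      using e by (auto simp del: of_nat_Suc simp: abs_of_nonneg)
  qed
  have w: "(\<lambda>x. u x + lam * v x) \<in> L2 nu" using u v by (intro L2_add L2_cmult)
  have step: "(\<integral>\<^sup>+ x. ennreal (e n (u x)) \<partial>nu) \<le> (\<integral>\<^sup>+ x. j (u x + lam * v x) \<partial>nu)" for n
  proof -
    have i: "integrable nu (\<lambda>x. (2 * real (Suc n) * lam) * (v x * R n (u x)))"
      using L2_mult_integrable[OF v L2_mono_contraction[OF mc u]] by (rule integrable_mult_right)
    have "(\<integral>x. e n (u x) \<partial>nu) \<le> (\<integral>x. e n (u x) \<partial>nu) + (2 * real (Suc n) * lam) * (\<integral>x. v x * R n (u x) \<partial>nu)"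
      using acc[OF mc[of n]] lam by simp
    also have "\<dots> = (\<integral>x. e n (u x) + (2 * real (Suc n) * lam) * (v x * R n (u x)) \<partial>nu)"
      using int_e[OF u] i by (simp del: of_nat_Suc)
    also have "\<dots> \<le> (\<integral>x. e n (u x + lam * v x) \<partial>nu)"
    proof (rule integral_mono)
      show "integrable nu (\<lambda>x. e n (u x) + (2 * real (Suc n) * lam) * (v x * R n (u x)))"
        using int_e[OF u] i by (rule Bochner_Integration.integrable_add)
      show "e n (u x) + (2 * real (Suc n) * lam) * (v x * R n (u x)) \<le> e n (u x + lam * v x)" for x
        using sub[of n "u x" "u x + lam * v x"] by (simp add: algebra_simps)
    qed (rule int_e[OF w])
    finally have "(\<integral>\<^sup>+ x. ennreal (e n (u x)) \<partial>nu) \<le> (\<integral>\<^sup>+ x. ennreal (e n (u x + lam * v x)) \<partial>nu)"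
      using int_e[OF u] int_e[OF w] e by (simp add: nn_integral_eq_integral)
    also have "\<dots> \<le> (\<integral>\<^sup>+ x. j (u x + lam * v x) \<partial>nu)"
      using e by (intro nn_integral_mono)
    finally show ?thesis .
  qed
  \<comment> \<open>Fatou's lemma is applied to the envelopes, which are measurable by continuity;
    \<open>j\<close> enters through pointwise comparison alone.\<close>
  have "(\<integral>\<^sup>+ x. j (u x) \<partial>nu) \<le> (\<integral>\<^sup>+ x. liminf (\<lambda>n. ennreal (e n (u x))) \<partial>nu)"
    by (intro nn_integral_mono lim)
  also have "\<dots> \<le> liminf (\<lambda>n. \<integral>\<^sup>+ x. ennreal (e n (u x)) \<partial>nu)"
    by (intro nn_integral_liminf measurable_compose[OF _ measurable_ennreal]
        measurable_compose[OF L2_measurable[OF u] em])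
  also have "\<dots> \<le> liminf (\<lambda>n::nat. \<integral>\<^sup>+ x. j (u x + lam * v x) \<partial>nu)"
    by (intro Liminf_mono always_eventually allI step)
  also have "\<dots> = (\<integral>\<^sup>+ x. j (u x + lam * v x) \<partial>nu)"
    by (simp add: Liminf_const)
  finally show ?thesis .
qed

lemma completely_accretive_subdiff:
  assumes ex: "\<And>u1 u2 R. u1 \<in> L2 nu \<Longrightarrow> u2 \<in> L2 nu \<Longrightarrow> mono_contraction R \<Longrightarrow>
    F (\<lambda>x. u1 x - R (u1 x - u2 x)) + F (\<lambda>x. u2 x + R (u1 x - u2 x)) \<le> F u1 + F u2"
  shows "completely_accretive nu (subdiff nu F)"
  unfolding completely_accretive_def
proof (rule conjI)
  show "subdiff nu F \<subseteq> L2 nu \<times> L2 nu" by (auto simp: subdiff_def)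
  show "\<forall>lam>0. \<forall>(u1, v1)\<in>subdiff nu F. \<forall>(u2, v2)\<in>subdiff nu F. \<forall>j. convex_enn j \<and> lsc_enn j \<and> j 0 = 0 \<longrightarrow>
      (\<integral>\<^sup>+ x. j (u1 x - u2 x) \<partial>nu) \<le> (\<integral>\<^sup>+ x. j (u1 x - u2 x + lam * (v1 x - v2 x)) \<partial>nu)"
  proof clarify
    fix lam :: real and u1 v1 u2 v2 and j :: "real \<Rightarrow> ennreal"
    assume lam: "lam > 0" and s: "(u1, v1) \<in> subdiff nu F" "(u2, v2) \<in> subdiff nu F"
      and j: "convex_enn j" "lsc_enn j" "j 0 = 0"
    have L: "u1 \<in> L2 nu" "v1 \<in> L2 nu" "u2 \<in> L2 nu" "v2 \<in> L2 nu"
      using s unfolding subdiff_iff by blast+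
    show "(\<integral>\<^sup>+ x. j (u1 x - u2 x) \<partial>nu) \<le> (\<integral>\<^sup>+ x. j (u1 x - u2 x + lam * (v1 x - v2 x)) \<partial>nu)"
    proof (rule nn_integral_convex_le_of_accretive[OF _ _ lam _ j])
      show "0 \<le> (\<integral>x. (v1 x - v2 x) * R (u1 x - u2 x) \<partial>nu)" if "mono_contraction R" for R
        by (rule subdiff_mono_contraction[OF s that ex[OF L(1,3) that]])
    qed (intro L2_diff L)+
  qed
qed

text \<open>The inequality holds for every pair \<open>(x, y)\<close>: the increment
  \<open>D\<close> of \<open>R (u1 - u2)\<close> from \<open>x\<close> to \<open>y\<close> lies
  between 0 and \<open>grad u1 x y - grad u2 x y\<close>, so \<open>convex_on_exchange\<close>
  applies to the gradients before integration against the weight \<open>K\<close>.\<close>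

lemma (in reversible_walk) energy_exchange:
  fixes \<phi> :: "real \<Rightarrow> real" and K :: "'a \<times> 'a \<Rightarrow> real"
  assumes \<phi>: "convex_on UNIV \<phi>" "\<And>s. \<phi> s \<ge> 0" and K: "K \<in> borel_measurable (nu \<Otimes>\<^sub>M nu)" "\<And>z. K z \<ge> 0"
    and u: "u1 \<in> borel_measurable nu" "u2 \<in> borel_measurable nu" and R: "mono_contraction R"
  shows "(\<integral>\<^sup>+ z. ennreal (\<phi> (grad (\<lambda>x. u1 x - R (u1 x - u2 x)) (fst z) (snd z)) * K z) \<partial>(nu_m nu m))
       + (\<integral>\<^sup>+ z. ennreal (\<phi> (grad (\<lambda>x. u2 x + R (u1 x - u2 x)) (fst z) (snd z)) * K z) \<partial>(nu_m nu m))
     \<le> (\<integral>\<^sup>+ z. ennreal (\<phi> (grad u1 (fst z) (snd z)) * K z) \<partial>(nu_m nu m))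
       + (\<integral>\<^sup>+ z. ennreal (\<phi> (grad u2 (fst z) (snd z)) * K z) \<partial>(nu_m nu m))"
proof -
  have \<phi>m: "\<phi> \<in> borel_measurable borel"
    using convex_on_continuous[OF open_UNIV \<phi>(1)] by (rule borel_measurable_continuous_onI)
  have m: "(\<lambda>z. ennreal (\<phi> (grad w (fst z) (snd z)) * K z)) \<in> borel_measurable (nu_m nu m)"
    if [measurable]: "w \<in> borel_measurable nu" for w
    unfolding measurable_nu_m_iff
    by (intro measurable_compose[OF _ measurable_ennreal] borel_measurable_times K
        measurable_compose[OF borel_measurable_grad \<phi>m] that)
  have [measurable]: "(\<lambda>x. R (u1 x - u2 x)) \<in> borel_measurable nu"
    by (intro measurable_compose[OF _ mono_contraction_measurable[OF R]] borel_measurable_diff u)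
  have w: "(\<lambda>x. u1 x - R (u1 x - u2 x)) \<in> borel_measurable nu" "(\<lambda>x. u2 x + R (u1 x - u2 x)) \<in> borel_measurable nu"
    using u by measurable
  have pt: "\<phi> (grad (\<lambda>x. u1 x - R (u1 x - u2 x)) x y) + \<phi> (grad (\<lambda>x. u2 x + R (u1 x - u2 x)) x y)
      \<le> \<phi> (grad u1 x y) + \<phi> (grad u2 x y)" for x y
  proof -
    define D where "D = R (u1 y - u2 y) - R (u1 x - u2 x)"
    have "0 \<le> D \<and> D \<le> (u1 y - u2 y) - (u1 x - u2 x) \<or> (u1 y - u2 y) - (u1 x - u2 x) \<le> D \<and> D \<le> 0"
      using R unfolding mono_contraction_def D_def by blast
    then have "0 \<le> D \<and> D \<le> grad u1 x y - grad u2 x y \<or> grad u1 x y - grad u2 x y \<le> D \<and> D \<le> 0"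
      unfolding grad_def by argo
    then have "\<phi> (grad u1 x y - D) + \<phi> (grad u2 x y + D) \<le> \<phi> (grad u1 x y) + \<phi> (grad u2 x y)"
      by (rule convex_on_exchange[OF \<phi>(1)])
    then show ?thesis by (simp add: grad_def D_def algebra_simps)
  qed
  show ?thesis
    unfolding nn_integral_add[OF m[OF w(1)] m[OF w(2)], symmetric]
      nn_integral_add[OF m[OF u(1)] m[OF u(2)], symmetric]
  proof (rule nn_integral_mono)
    fix z
    have "(\<phi> (grad (\<lambda>x. u1 x - R (u1 x - u2 x)) (fst z) (snd z)) + \<phi> (grad (\<lambda>x. u2 x + R (u1 x - u2 x)) (fst z) (snd z))) * K z
      \<le> (\<phi> (grad u1 (fst z) (snd z)) + \<phi> (grad u2 (fst z) (snd z))) * K z"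
      by (intro mult_right_mono pt K)
    then show "ennreal (\<phi> (grad (\<lambda>x. u1 x - R (u1 x - u2 x)) (fst z) (snd z)) * K z)
        + ennreal (\<phi> (grad (\<lambda>x. u2 x + R (u1 x - u2 x)) (fst z) (snd z)) * K z)
      \<le> ennreal (\<phi> (grad u1 (fst z) (snd z)) * K z) + ennreal (\<phi> (grad u2 (fst z) (snd z)) * K z)"
      using \<phi>(2) K(2) by (simp add: ennreal_plus[symmetric] ring_distribs del: ennreal_plus)
  qed
qed

section \<open>First variation of the p-energy\<close>

locale p_laplace_walk = reversible_walk nu m
  for nu :: "'a measure" and m :: "'a \<Rightarrow> 'a measure" +
  fixes B :: "'a \<Rightarrow> 'a set" and p :: real
  assumes p: "p > 1"
    and B_meas: "{(x, y). x \<in> space nu \<and> y \<in> B x} \<in> sets (nu \<Otimes>\<^sub>M nu)"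
    and finite_or_p_ge_2: "emeasure nu (space nu) < \<infinity> \<or> p \<ge> 2"
begin

abbreviation M :: "('a \<times> 'a) measure" where "M \<equiv> nu_m nu m"

definition dens :: "('a \<Rightarrow> real) \<Rightarrow> 'a \<times> 'a \<Rightarrow> real" where
  "dens u z = Kker B (fst z) (snd z) * \<bar>grad u (fst z) (snd z)\<bar> powr p"

definition flux :: "('a \<Rightarrow> real) \<Rightarrow> 'a \<times> 'a \<Rightarrow> real" where
  "flux u z = Kker B (fst z) (snd z) * signed_pow p (grad u (fst z) (snd z))"

text \<open>Where the flux is not \<open>m x\<close>-integrable the Bochner integral has the default
  value 0; \<open>AE_flux_integrable\<close> makes these points negligible when the p-energy is
  finite.\<close>

definition plap :: "('a \<Rightarrow> real) \<Rightarrow> 'a \<Rightarrow> real" where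
  "plap u x = (\<integral>y. flux u (x, y) \<partial>(m x))"

lemma K_measurable [measurable]: "(\<lambda>z. Kker B (fst z) (snd z)) \<in> borel_measurable (nu \<Otimes>\<^sub>M nu)"
  by (rule borel_measurable_Kker[OF B_meas])

lemma dens_measurable [measurable]: "u \<in> borel_measurable nu \<Longrightarrow> dens u \<in> borel_measurable (nu \<Otimes>\<^sub>M nu)"
  unfolding dens_def[abs_def] by measurable

lemma flux_measurable [measurable]: "u \<in> borel_measurable nu \<Longrightarrow> flux u \<in> borel_measurable (nu \<Otimes>\<^sub>M nu)"
  unfolding flux_def[abs_def] by measurable

lemma plap_measurable [measurable]: "u \<in> borel_measurable nu \<Longrightarrow> plap u \<in> borel_measurable nu"
  unfolding plap_def[abs_def] by (rule measurable_kernel_integral) simp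

lemma flux_antisym: "flux u (y, x) = - flux u (x, y)"
  by (simp add: flux_def Kker_commute grad_commute[of u y x] signed_pow_minus)

lemma dens_nonneg: "0 \<le> dens u z"
  by (simp add: dens_def Kker_nonneg)

lemma F_p_dens: "F_p nu m B p u = (\<integral>\<^sup>+ z. ennreal (dens u z / (2 * p)) \<partial>M)"
  by (simp add: F_p_def dens_def mult.commute)

lemma F_p_finite_iff:
  assumes [measurable]: "u \<in> borel_measurable nu"
  shows "F_p nu m B p u < \<infinity> \<longleftrightarrow> integrable M (dens u)"
proof
  assume "F_p nu m B p u < \<infinity>"
  then have "integrable M (\<lambda>z. dens u z / (2 * p))"
    unfolding F_p_dens using p by (intro integrable_finite_nn_integral) (auto simp: dens_nonneg)
  then have "integrable M (\<lambda>z. (2 * p) * (dens u z / (2 * p)))" by (rule integrable_mult_right)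
  then show "integrable M (dens u)" using p by simp
next
  assume "integrable M (dens u)"
  then have "integrable M (\<lambda>z. dens u z / (2 * p))" by simp
  then show "F_p nu m B p u < \<infinity>"
    unfolding F_p_dens using p dens_nonneg by (simp add: nn_integral_eq_integral)
qed

lemma F_p_eq:
  assumes [measurable]: "u \<in> borel_measurable nu" and i: "integrable M (dens u)"
  shows "enn2real (F_p nu m B p u) = (\<integral>z. dens u z / (2 * p) \<partial>M)"
proof -
  have "(\<integral>\<^sup>+ z. ennreal (dens u z / (2 * p)) \<partial>M) < \<infinity>"
    using i F_p_finite_iff[of u] by (simp add: F_p_dens)
  then show ?thesis
    unfolding F_p_dens using p by (intro enn2real_nn_integral) (auto simp: dens_nonneg)
qed

text \<open>One of the two places where the dichotomy on \<open>nu\<close> and \<open>p\<close>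
  enters: for \<open>p \<ge> 2\<close> the surplus power \<open>p - 2\<close> is absorbed into a
  constant, otherwise \<open>k powr p\<close> is integrable. It makes bounded L2 functions
  admissible directions for \<open>F_p\<close>.\<close>

lemma integrable_powr_bounded:
  assumes f: "f \<in> L2 nu" and k: "\<And>x. \<bar>f x\<bar> \<le> k"
  shows "integrable nu (\<lambda>x. \<bar>f x\<bar> powr p)"
proof -
  have [measurable]: "f \<in> borel_measurable nu" using f by (rule L2_measurable)
  show ?thesis
  proof (cases "p \<ge> 2")
    case True
    have le: "\<bar>f x\<bar> powr p \<le> k powr (p - 2) * (f x)\<^sup>2" for x
    proof -
      have "\<bar>f x\<bar> powr p = \<bar>f x\<bar> powr (p - 2) * (f x)\<^sup>2"
        by (cases "f x = 0") (simp_all add: powr_diff)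
      also have "\<dots> \<le> k powr (p - 2) * (f x)\<^sup>2"
        using True k by (intro mult_right_mono powr_mono2) auto
      finally show ?thesis .
    qed
    show ?thesis
    proof (rule Bochner_Integration.integrable_bound)
      show "integrable nu (\<lambda>x. k powr (p - 2) * (f x)\<^sup>2)" using L2_integrable[OF f] by simp
      show "AE x in nu. norm (\<bar>f x\<bar> powr p) \<le> norm (k powr (p - 2) * (f x)\<^sup>2)" using le by auto
    qed measurable
  next
    case False
    then have "emeasure nu (space nu) \<noteq> \<infinity>" using finite_or_p_ge_2 by auto
    then interpret finite_measure nu by (rule finite_measureI)
    show ?thesis
    proof (rule Bochner_Integration.integrable_bound)
      show "integrable nu (\<lambda>x. k powr p)" by simp
      show "AE x in nu. norm (\<bar>f x\<bar> powr p) \<le> norm (k powr p)"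
        using p k by (auto intro!: powr_mono2)
    qed measurable
  qed
qed

lemma dens_integrable_of_powr:
  assumes [measurable]: "f \<in> borel_measurable nu" and i: "integrable nu (\<lambda>x. \<bar>f x\<bar> powr p)"
  shows "integrable M (dens f)"
proof (rule Bochner_Integration.integrable_bound)
  show "integrable M (\<lambda>z. 2 powr p * (\<bar>f (snd z)\<bar> powr p + \<bar>f (fst z)\<bar> powr p))"
    using integrable_nu_m_fst[OF i] integrable_nu_m_snd[OF i] by simp
  have "dens f z \<le> 2 powr p * (\<bar>f (snd z)\<bar> powr p + \<bar>f (fst z)\<bar> powr p)" for z
  proof -
    have "dens f z \<le> 1 * \<bar>grad f (fst z) (snd z)\<bar> powr p"
      unfolding dens_def by (intro mult_right_mono Kker_le_1) auto
    also have "\<dots> \<le> (\<bar>f (snd z)\<bar> + \<bar>f (fst z)\<bar>) powr p"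
      using p by (auto simp: grad_def intro!: powr_mono2)
    also have "\<dots> \<le> 2 powr p * (\<bar>f (snd z)\<bar> powr p + \<bar>f (fst z)\<bar> powr p)"
      using p by (intro powr_add_le) auto
    finally show ?thesis .
  qed
  then show "AE z in M. norm (dens f z) \<le> norm (2 powr p * (\<bar>f (snd z)\<bar> powr p + \<bar>f (fst z)\<bar> powr p))"
    by (auto simp: abs_of_nonneg dens_nonneg)
qed measurable

lemma dens_add_le: "dens (\<lambda>x. u x + w x) z \<le> 2 powr p * (dens u z + dens w z)"
proof -
  have "\<bar>grad (\<lambda>x. u x + w x) (fst z) (snd z)\<bar> powr p
      \<le> (\<bar>grad u (fst z) (snd z)\<bar> + \<bar>grad w (fst z) (snd z)\<bar>) powr p"
    using p by (intro powr_mono2) (auto simp: grad_def)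
  also have "\<dots> \<le> 2 powr p * (\<bar>grad u (fst z) (snd z)\<bar> powr p + \<bar>grad w (fst z) (snd z)\<bar> powr p)"
    using p by (intro powr_add_le) auto
  finally show ?thesis
    unfolding dens_def using mult_left_mono[OF _ Kker_nonneg[of B "fst z" "snd z"]]
    by (fastforce simp: algebra_simps)
qed

lemma dens_add_integrable:
  assumes [measurable]: "u \<in> borel_measurable nu" "w \<in> borel_measurable nu"
    and i: "integrable M (dens u)" "integrable M (dens w)"
  shows "integrable M (dens (\<lambda>x. u x + w x))"
proof (rule Bochner_Integration.integrable_bound)
  show "integrable M (\<lambda>z. 2 powr p * (dens u z + dens w z))" using i by simp
  show "AE z in M. norm (dens (\<lambda>x. u x + w x) z) \<le> norm (2 powr p * (dens u z + dens w z))"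
    using dens_add_le by (auto simp: abs_of_nonneg dens_nonneg)
qed measurable

lemma dens_cmult: "dens (\<lambda>x. t * u x) z = \<bar>t\<bar> powr p * dens u z"
proof -
  have "grad (\<lambda>x. t * u x) (fst z) (snd z) = t * grad u (fst z) (snd z)"
    by (simp add: grad_def algebra_simps)
  then show ?thesis by (simp add: dens_def abs_mult powr_mult)
qed

text \<open>A Young inequality with crude constants, enough for domination. The kernel is kept on
  the last term so that it becomes a \<open>dens\<close> when \<open>s\<close> is a
  gradient.\<close>

lemma flux_mult_le:
  "\<bar>flux u z * s\<bar> \<le> dens u z + Kker B (fst z) (snd z) * \<bar>s\<bar> powr p"
proof -
  have "\<bar>flux u z * s\<bar> = Kker B (fst z) (snd z) * (\<bar>grad u (fst z) (snd z)\<bar> powr (p - 1) * \<bar>s\<bar>)"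
    by (simp add: flux_def abs_mult abs_signed_pow Kker_nonneg abs_of_nonneg)
  also have "\<dots> \<le> Kker B (fst z) (snd z) * (\<bar>grad u (fst z) (snd z)\<bar> powr p + \<bar>s\<bar> powr p)"
    using p by (intro mult_left_mono powr_pred_mult_le Kker_nonneg) auto
  finally show ?thesis by (simp add: dens_def algebra_simps)
qed

lemma flux_grad_integrable:
  assumes [measurable]: "u \<in> borel_measurable nu" "w \<in> borel_measurable nu"
    and i: "integrable M (dens u)" "integrable M (dens w)"
  shows "integrable M (\<lambda>z. flux u z * grad w (fst z) (snd z))"
proof (rule Bochner_Integration.integrable_bound)
  show "integrable M (\<lambda>z. dens u z + dens w z)" using i by simp
  show "AE z in M. norm (flux u z * grad w (fst z) (snd z)) \<le> norm (dens u z + dens w z)"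
    using flux_mult_le[of u _ "grad w _ _"] by (auto simp: dens_def abs_of_nonneg Kker_nonneg)
qed measurable

lemma flux_fst_integrable:
  assumes [measurable]: "u \<in> borel_measurable nu" "f \<in> borel_measurable nu"
    and i: "integrable M (dens u)" "integrable nu (\<lambda>x. \<bar>f x\<bar> powr p)"
  shows "integrable M (\<lambda>z. flux u z * f (fst z))"
proof (rule Bochner_Integration.integrable_bound)
  show "integrable M (\<lambda>z. dens u z + \<bar>f (fst z)\<bar> powr p)" using i integrable_nu_m_fst[OF i(2)] by simp
  have "\<bar>flux u z * f (fst z)\<bar> \<le> dens u z + \<bar>f (fst z)\<bar> powr p" for z
  proof -
    have "Kker B (fst z) (snd z) * \<bar>f (fst z)\<bar> powr p \<le> 1 * \<bar>f (fst z)\<bar> powr p"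
      by (intro mult_right_mono Kker_le_1) auto
    then show ?thesis using flux_mult_le[of u z "f (fst z)"] by linarith
  qed
  then show "AE z in M. norm (flux u z * f (fst z)) \<le> norm (dens u z + \<bar>f (fst z)\<bar> powr p)"
    by (auto simp: abs_of_nonneg dens_nonneg)
qed measurable

lemma
  assumes u: "u \<in> borel_measurable nu" "integrable M (dens u)" and f: "f \<in> L2 nu" "\<And>x. \<bar>f x\<bar> \<le> k"
  shows plap_integrable: "integrable nu (\<lambda>x. plap u x * f x)"
    and plap_parts: "(\<integral>z. flux u z * grad f (fst z) (snd z) / 2 \<partial>M) = - (\<integral>x. plap u x * f x \<partial>nu)"
proof -
  have i: "integrable M (\<lambda>z. flux u z * f (fst z))"
    by (intro flux_fst_integrable u L2_measurable[OF f(1)] integrable_powr_bounded[OF f])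
  show "integrable nu (\<lambda>x. plap u x * f x)"
    unfolding plap_def
    by (rule parts_integrable_div[OF flux_measurable[OF u(1)] flux_antisym i L2_measurable[OF f(1)]])
  show "(\<integral>z. flux u z * grad f (fst z) (snd z) / 2 \<partial>M) = - (\<integral>x. plap u x * f x \<partial>nu)"
    unfolding plap_def
    by (rule parts[OF flux_measurable[OF u(1)] flux_antisym i L2_measurable[OF f(1)]])
qed

text \<open>The flux itself need not be integrable on the product when \<open>nu\<close> is
  infinite; restricted to \<open>fst z\<close> in a set of finite measure it is, and countably many
  such sets exhaust the space.\<close>

lemma AE_flux_integrable:
  assumes u: "u \<in> borel_measurable nu" "integrable M (dens u)"
  shows "AE x in nu. integrable (m x) (\<lambda>y. flux u (x, y))"
proof -
  interpret sigma_finite_measure nu by (rule sigma_finite_nu)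
  obtain D :: "nat \<Rightarrow> 'a set" where D: "range D \<subseteq> sets nu" "(\<Union>i. D i) = space nu" "\<And>i. emeasure nu (D i) \<noteq> \<infinity>"
    using sigma_finite by blast
  have "AE x in nu. x \<in> D n \<longrightarrow> integrable (m x) (\<lambda>y. flux u (x, y))" for n
  proof -
    have Ds: "D n \<in> sets nu" "emeasure nu (D n) < \<infinity>" using D by (auto simp: less_top)
    have f: "(indicator (D n) :: 'a \<Rightarrow> real) \<in> L2 nu" by (rule L2_indicator[OF Ds])
    have "integrable nu (\<lambda>x. \<bar>indicator (D n) x\<bar> powr p)"
      by (rule integrable_powr_bounded[OF f, of 1]) (auto simp: indicator_def)
    then have "integrable M (\<lambda>z. flux u z * indicator (D n) (fst z))"
      by (intro flux_fst_integrable u L2_measurable[OF f])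
    from AE_nu_m_section[OF this] show ?thesis by eventually_elim auto
  qed
  then have "AE x in nu. \<forall>n. x \<in> D n \<longrightarrow> integrable (m x) (\<lambda>y. flux u (x, y))"
    by (subst AE_all_countable) blast
  then show ?thesis using AE_space by eventually_elim (use D(2) in auto)
qed

lemma dens_subgradient:
  "dens u z / (2 * p) + flux u z * (grad w (fst z) (snd z) - grad u (fst z) (snd z)) / 2 \<le> dens w z / (2 * p)"
  using mult_left_mono[OF powr_subgradient[OF p, of "grad u (fst z) (snd z)" "grad w (fst z) (snd z)"],
      of "Kker B (fst z) (snd z) / 2"] Kker_nonneg[of B "fst z" "snd z"]
  by (simp add: dens_def flux_def algebra_simps diff_divide_distrib)

text \<open>\<open>F_p\<close> is differentiable along bounded \<open>L2\<close> directions, so only the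
  other summand \<open>H\<close> survives as a difference quotient.\<close>

lemma subdiff_sum_variation:
  assumes uv: "(u, v) \<in> subdiff nu (\<lambda>u. H u + F_p nu m B p u)"
    and f: "f \<in> L2 nu" "\<And>x. \<bar>f x\<bar> \<le> k"
    and H: "H (\<lambda>x. u x + f x) < \<infinity>"
      "\<And>t. 0 \<le> t \<Longrightarrow> t \<le> 1 \<Longrightarrow> H (\<lambda>x. u x + t * f x) \<le> ennreal (1 - t) * H u + ennreal t * H (\<lambda>x. u x + f x)"
  shows "(\<integral>x. v x * f x \<partial>nu) \<le> enn2real (H (\<lambda>x. u x + f x)) - enn2real (H u) - (\<integral>x. plap u x * f x \<partial>nu)"
proof -
  have uL: "u \<in> L2 nu" "v \<in> L2 nu" and fin: "H u + F_p nu m B p u < \<infinity>"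
    and ineq: "\<And>w. w \<in> L2 nu \<Longrightarrow> H w + F_p nu m B p w < \<infinity> \<Longrightarrow>
      enn2real (H u + F_p nu m B p u) + (\<integral>x. v x * (w x - u x) \<partial>nu) \<le> enn2real (H w + F_p nu m B p w)"
    using uv unfolding subdiff_iff by blast+
  have um[measurable]: "u \<in> borel_measurable nu" and fm[measurable]: "f \<in> borel_measurable nu"
    using uL f by (auto intro: L2_measurable)
  have Hu: "H u < \<infinity>" and Fu: "F_p nu m B p u < \<infinity>" using fin by auto
  have du: "integrable M (dens u)" using Fu F_p_finite_iff[OF um] by blast
  have df: "integrable M (dens f)" by (rule dens_integrable_of_powr[OF fm integrable_powr_bounded[OF f]])
  define t where "t n = 1 / real (Suc n)" for n
  have t: "0 < t n" "t n \<le> 1" for n by (auto simp: t_def)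
  define w where "w n x = u x + t n * f x" for n x
  have wL: "w n \<in> L2 nu" for n unfolding w_def by (intro L2_add L2_cmult uL f)
  have wm[measurable]: "w n \<in> borel_measurable nu" for n by (rule L2_measurable[OF wL])
  have dtf: "integrable M (dens (\<lambda>x. t n * f x))" for n
    using df by (simp add: dens_cmult[abs_def])
  have dw: "integrable M (dens (w n))" for n
    unfolding w_def using dens_add_integrable[OF um _ du dtf] by simp
  have gw: "grad (w n) x y = grad u x y + t n * grad f x y" for n x y
    by (simp add: grad_def w_def algebra_simps)
  let ?I = "\<lambda>w. \<integral>z. flux w z * grad f (fst z) (snd z) / 2 \<partial>M"
  let ?h0 = "enn2real (H u)" and ?h1 = "enn2real (H (\<lambda>x. u x + f x))"
  have step: "(\<integral>x. v x * f x \<partial>nu) \<le> ?h1 - ?h0 + ?I (w n)" for n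
  proof -
    have Hw: "H (w n) \<le> ennreal (1 - t n) * H u + ennreal (t n) * H (\<lambda>x. u x + f x)"
      unfolding w_def using t[of n] by (intro H(2)) auto
    have rfin: "ennreal (1 - t n) * H u + ennreal (t n) * H (\<lambda>x. u x + f x) < \<infinity>"
      using Hu H(1) by (simp add: ennreal_mult_less_top)
    have Hwf: "H (w n) < \<infinity>" using order_le_less_trans[OF Hw rfin] .
    have Fwf: "F_p nu m B p (w n) < \<infinity>" using dw F_p_finite_iff[OF wm] by blast
    have hw: "enn2real (H (w n)) \<le> (1 - t n) * ?h0 + t n * ?h1"
      using enn2real_mono[OF Hw] rfin Hu H(1) t[of n]
      by (simp add: enn2real_plus enn2real_mult ennreal_mult_less_top)
    have "enn2real (F_p nu m B p (w n)) - enn2real (F_p nu m B p u)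
        = (\<integral>z. dens (w n) z / (2 * p) - dens u z / (2 * p) \<partial>M)"
      using F_p_eq[OF wm dw] F_p_eq[OF um du] dw du by simp
    \<comment> \<open>The subgradient is taken at the moved point \<open>w n\<close> instead of
      \<open>u\<close>: this bounds the increase of the energy from above, and the flux of
      \<open>w n\<close> converges to that of \<open>u\<close>.\<close>
    also have "\<dots> \<le> (\<integral>z. t n * (flux (w n) z * grad f (fst z) (snd z) / 2) \<partial>M)"
    proof (rule integral_mono)
      show "integrable M (\<lambda>z. dens (w n) z / (2 * p) - dens u z / (2 * p))" using dw du by simp
      show "integrable M (\<lambda>z. t n * (flux (w n) z * grad f (fst z) (snd z) / 2))"
        using flux_grad_integrable[OF wm fm dw df] by simp
      show "dens (w n) z / (2 * p) - dens u z / (2 * p) \<le> t n * (flux (w n) z * grad f (fst z) (snd z) / 2)" for z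
        using dens_subgradient[of "w n" z u] unfolding gw by (simp add: algebra_simps)
    qed
    finally have Fdiff: "enn2real (F_p nu m B p (w n)) - enn2real (F_p nu m B p u) \<le> t n * ?I (w n)"
      by simp
    have "enn2real (H u + F_p nu m B p u) + (\<integral>x. v x * (w n x - u x) \<partial>nu) \<le> enn2real (H (w n) + F_p nu m B p (w n))"
      using Hwf Fwf by (intro ineq wL) auto
    then have "?h0 + enn2real (F_p nu m B p u) + t n * (\<integral>x. v x * f x \<partial>nu)
        \<le> enn2real (H (w n)) + enn2real (F_p nu m B p (w n))"
      using Hwf Fwf Hu Fu by (simp add: enn2real_plus w_def mult.left_commute)
    then have "t n * (\<integral>x. v x * f x \<partial>nu) \<le> t n * (?h1 - ?h0 + ?I (w n))"
      using hw Fdiff by (simp add: algebra_simps)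
    then show ?thesis using t[of n] by simp
  qed
  have tlim: "t \<longlonglongrightarrow> 0"
    unfolding t_def using LIMSEQ_inverse_real_of_nat by (simp add: inverse_eq_divide)
  have "(\<lambda>n. ?I (w n)) \<longlonglongrightarrow> ?I u"
  proof (rule integral_dominated_convergence)
    show "(\<lambda>z. flux u z * grad f (fst z) (snd z) / 2) \<in> borel_measurable M"
      "(\<lambda>z. flux (w n) z * grad f (fst z) (snd z) / 2) \<in> borel_measurable M" for n
      by measurable
    show "integrable M (\<lambda>z. 2 powr p * (dens u z + dens f z) + dens f z)" using du df by simp
    have "(\<lambda>n. flux (w n) z * grad f (fst z) (snd z) / 2) \<longlonglongrightarrow> flux u z * grad f (fst z) (snd z) / 2" for z
    proof -
      have "(\<lambda>n. grad (w n) (fst z) (snd z)) \<longlonglongrightarrow> grad u (fst z) (snd z) + 0 * grad f (fst z) (snd z)"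
        unfolding gw by (intro tendsto_intros tlim)
      then have "(\<lambda>n. signed_pow p (grad (w n) (fst z) (snd z))) \<longlonglongrightarrow> signed_pow p (grad u (fst z) (snd z))"
        by (intro isCont_tendsto_compose[OF continuous_signed_pow[OF p]]) simp
      then show ?thesis unfolding flux_def by (intro tendsto_intros) simp_all
    qed
    then show "AE z in M. (\<lambda>n. flux (w n) z * grad f (fst z) (snd z) / 2) \<longlonglongrightarrow> flux u z * grad f (fst z) (snd z) / 2"
      by simp
    \<comment> \<open>Since \<open>t n \<le> 1\<close>, the density of \<open>w n\<close> is bounded
      independently of \<open>n\<close> by those of \<open>u\<close> and \<open>f\<close>, which
      supplies the dominating function.\<close>
    have "norm (flux (w n) z * grad f (fst z) (snd z) / 2) \<le> 2 powr p * (dens u z + dens f z) + dens f z" for n z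
    proof -
      have "\<bar>flux (w n) z * grad f (fst z) (snd z)\<bar> \<le> dens (w n) z + dens f z"
        using flux_mult_le[of "w n" z "grad f (fst z) (snd z)"] by (simp add: dens_def)
      moreover have "dens (w n) z \<le> 2 powr p * (dens u z + dens (\<lambda>x. t n * f x) z)"
        unfolding w_def by (rule dens_add_le)
      moreover have "dens (\<lambda>x. t n * f x) z \<le> 1 * dens f z"
        unfolding dens_cmult using t[of n] p by (intro mult_right_mono dens_nonneg) (auto intro: powr_le1)
      then have "2 powr p * (dens u z + dens (\<lambda>x. t n * f x) z) \<le> 2 powr p * (dens u z + dens f z)" by simp
      moreover have "norm (flux (w n) z * grad f (fst z) (snd z) / 2) \<le> \<bar>flux (w n) z * grad f (fst z) (snd z)\<bar>" by simp
      ultimately show ?thesis by linarith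
    qed
    then show "AE z in M. norm (flux (w n) z * grad f (fst z) (snd z) / 2) \<le> 2 powr p * (dens u z + dens f z) + dens f z" for n
      by simp
  qed
  then have "(\<lambda>n. ?h1 - ?h0 + ?I (w n)) \<longlonglongrightarrow> ?h1 - ?h0 + ?I u" by (intro tendsto_intros)
  then have "(\<integral>x. v x * f x \<partial>nu) \<le> ?h1 - ?h0 + ?I u"
    by (rule LIMSEQ_le_const) (use step in auto)
  then show ?thesis using plap_parts[OF um du f] by simp
qed

end

section \<open>The p-Laplacian as a subdifferential\<close>

lemma subdiff_add:
  assumes "(u, v1) \<in> subdiff nu F" "(u, v2) \<in> subdiff nu H"
  shows "(u, \<lambda>x. v1 x + v2 x) \<in> subdiff nu (\<lambda>u. F u + H u)"
proof -
  have L: "u \<in> L2 nu" "v1 \<in> L2 nu" "v2 \<in> L2 nu" "F u < \<infinity>" "H u < \<infinity>"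
    and 1: "\<And>w. w \<in> L2 nu \<Longrightarrow> F w < \<infinity> \<Longrightarrow> enn2real (F u) + (\<integral>x. v1 x * (w x - u x) \<partial>nu) \<le> enn2real (F w)"
    and 2: "\<And>w. w \<in> L2 nu \<Longrightarrow> H w < \<infinity> \<Longrightarrow> enn2real (H u) + (\<integral>x. v2 x * (w x - u x) \<partial>nu) \<le> enn2real (H w)"
    using assms unfolding subdiff_iff by blast+
  have "enn2real (F u + H u) + (\<integral>x. (v1 x + v2 x) * (w x - u x) \<partial>nu) \<le> enn2real (F w + H w)"
    if w: "w \<in> L2 nu" "F w + H w < \<infinity>" for w
  proof -
    have fin: "F w < \<infinity>" "H w < \<infinity>" using w(2) by auto
    have "(\<integral>x. (v1 x + v2 x) * (w x - u x) \<partial>nu) = (\<integral>x. v1 x * (w x - u x) \<partial>nu) + (\<integral>x. v2 x * (w x - u x) \<partial>nu)"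
      using L2_mult_integrable[OF L(2) L2_diff[OF w(1) L(1)]] L2_mult_integrable[OF L(3) L2_diff[OF w(1) L(1)]]
      by (simp add: distrib_right)
    then show ?thesis using 1[OF w(1) fin(1)] 2[OF w(1) fin(2)] fin L by (simp add: enn2real_plus)
  qed
  moreover have "F u + H u < \<infinity>" using L by simp
  ultimately show ?thesis unfolding subdiff_iff using L(1) L2_add[OF L(2,3)] by blast
qed

lemma op_neg_iff: "(u, w) \<in> op_neg D \<longleftrightarrow> (u, \<lambda>x. - w x) \<in> D"
proof
  assume "(u, \<lambda>x. - w x) \<in> D"
  then show "(u, w) \<in> op_neg D"
    unfolding op_neg_def mem_Collect_eq by (intro exI[of _ u] exI[of _ "\<lambda>x. - w x"]) simp
next
  assume "(u, w) \<in> op_neg D"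
  then obtain v where "w = (\<lambda>x. - v x)" "(u, v) \<in> D"
    unfolding op_neg_def by blast
  then show "(u, \<lambda>x. - w x) \<in> D" by simp
qed

lemma op_neg_Delta_1: "op_neg (Delta_1 nu m A) = subdiff nu (F_1 nu m A)"
proof -
  have "(u, v) \<in> op_neg (Delta_1 nu m A) \<longleftrightarrow> (u, v) \<in> subdiff nu (F_1 nu m A)" for u v
    unfolding op_neg_iff Delta_1_def mem_Collect_eq prod.case minus_minus ..
  then show ?thesis by (intro equalityI subrelI) blast+
qed

context p_laplace_walk
begin

text \<open>Sectionwise integrability of the flux comes from \<open>AE_flux_integrable\<close>, so
  membership reduces to an almost-everywhere identity.\<close>

lemma Delta_p_iff:
  "(u, v) \<in> Delta_p nu m B p \<longleftrightarrow> u \<in> L2 nu \<and> v \<in> L2 nu \<and> integrable M (dens u) \<and> (AE x in nu. v x = plap u x)"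
proof (cases "u \<in> L2 nu")
  case True
  then have um[measurable]: "u \<in> borel_measurable nu" by (rule L2_measurable)
  have K: "Kker B x y * \<bar>grad u x y\<bar> powr (p - 2) * grad u x y = flux u (x, y)" for x y
    by (simp add: flux_def signed_pow_def mult.assoc)
  have fin: "(\<integral>\<^sup>+ z. ennreal (Kker B (fst z) (snd z) * \<bar>grad u (fst z) (snd z)\<bar> powr p) \<partial>M) < \<infinity> \<longleftrightarrow> integrable M (dens u)"
    unfolding dens_def[symmetric] integrable_iff_bounded by (simp add: dens_nonneg)
  show ?thesis
  proof (cases "integrable M (dens u)")
    case True
    then show ?thesis
      unfolding Delta_p_def mem_Collect_eq prod.case K plap_def[symmetric]
      using AE_flux_integrable[OF um True] fin by (simp add: AE_conj_iff)
  qed (use fin in \<open>simp add: Delta_p_def\<close>)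
qed (simp add: Delta_p_def)

text \<open>The assumed inequality is tested with plus and minus indicators of sets of finite
  measure. The constant is a parameter because \<open>c = 0\<close> identifies the subgradients of
  \<open>F_p\<close>, while \<open>c = 1\<close> bounds the contribution of the total variation
  term.\<close>

lemma AE_abs_add_plap_le:
  assumes u: "u \<in> borel_measurable nu" "integrable M (dens u)" and v: "v \<in> L2 nu"
    and le: "\<And>f. f \<in> L2 nu \<Longrightarrow> (\<And>x. \<bar>f x\<bar> \<le> 1) \<Longrightarrow> integrable nu f \<Longrightarrow>
      (\<integral>x. v x * f x \<partial>nu) \<le> c * (\<integral>x. \<bar>f x\<bar> \<partial>nu) - (\<integral>x. plap u x * f x \<partial>nu)"
  shows "AE x in nu. \<bar>v x + plap u x\<bar> \<le> c"
proof -
  interpret sigma_finite_measure nu by (rule sigma_finite_nu)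
  have [measurable]: "v \<in> borel_measurable nu" "plap u \<in> borel_measurable nu"
    using L2_measurable[OF v] plap_measurable[OF u(1)] by auto
  have "AE x in nu. s * (v x + plap u x) \<le> c" if s: "s = 1 \<or> s = -1" for s
  proof (rule AE_le_of_set_integral_le)
    fix S assume S: "S \<in> sets nu" "emeasure nu S < \<infinity>"
    have f: "(\<lambda>x. s * indicator S x) \<in> L2 nu" by (intro L2_cmult L2_indicator S)
    have f1: "\<bar>s * indicator S x\<bar> \<le> 1" for x :: 'a using s by (auto simp: indicator_def)
    have fi: "integrable nu (\<lambda>x. s * indicator S x)" using S by simp
    have iv: "integrable nu (\<lambda>x. v x * (s * indicator S x))" by (rule L2_mult_integrable[OF v f])
    have ip: "integrable nu (\<lambda>x. plap u x * (s * indicator S x))" by (rule plap_integrable[OF u f f1])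
    have eq: "s * (v x + plap u x) * indicator S x = v x * (s * indicator S x) + plap u x * (s * indicator S x)" for x
      by (simp add: algebra_simps)
    show "integrable nu (\<lambda>x. s * (v x + plap u x) * indicator S x)"
      unfolding eq using iv ip by (rule Bochner_Integration.integrable_add)
    have "(\<integral>x. \<bar>s * indicator S x\<bar> \<partial>nu) = (\<integral>x. indicator S x \<partial>nu)"
      using s by (intro Bochner_Integration.integral_cong) (auto simp: indicator_def)
    also have "\<dots> = measure nu S" using sets.sets_into_space[OF S(1)] by (simp add: Int_absorb2)
    finally have ms: "(\<integral>x. \<bar>s * indicator S x\<bar> \<partial>nu) = measure nu S" .
    show "(\<integral>x. s * (v x + plap u x) * indicator S x \<partial>nu) \<le> c * measure nu S"
      unfolding eq using le[OF f f1 fi] iv ip by (simp only: Bochner_Integration.integral_add ms)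
  qed measurable
  from this[of 1] this[of "-1"] have "AE x in nu. v x + plap u x \<le> c" "AE x in nu. - (v x + plap u x) \<le> c"
    by simp_all
  then show ?thesis by eventually_elim (auto simp: abs_le_iff)
qed

lemma subdiff_F_p_imp_Delta_p:
  assumes uv: "(u, v) \<in> subdiff nu (F_p nu m B p)"
  shows "(u, \<lambda>x. - v x) \<in> Delta_p nu m B p"
proof -
  have L: "u \<in> L2 nu" "v \<in> L2 nu" "F_p nu m B p u < \<infinity>" using uv unfolding subdiff_iff by blast+
  have um: "u \<in> borel_measurable nu" by (rule L2_measurable[OF L(1)])
  have du: "integrable M (dens u)" using L(3) F_p_finite_iff[OF um] by blast
  \<comment> \<open>\<open>F_p\<close> is viewed as a sum whose other term vanishes, so that the
    variation inequality holds with \<open>c = 0\<close>.\<close>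
  have uv0: "(u, v) \<in> subdiff nu (\<lambda>u. 0 + F_p nu m B p u)" using uv by simp
  have "AE x in nu. \<bar>v x + plap u x\<bar> \<le> 0"
  proof (rule AE_abs_add_plap_le[OF um du L(2)])
    fix f assume f: "f \<in> L2 nu" "\<And>x. \<bar>f x\<bar> \<le> 1"
    show "(\<integral>x. v x * f x \<partial>nu) \<le> 0 * (\<integral>x. \<bar>f x\<bar> \<partial>nu) - (\<integral>x. plap u x * f x \<partial>nu)"
      using subdiff_sum_variation[OF uv0 f] by simp
  qed
  then have "AE x in nu. - v x = plap u x" by eventually_elim simp
  then show ?thesis unfolding Delta_p_iff using L du L2_uminus[OF L(2)] by blast
qed

text \<open>The difference \<open>w - u\<close> is in L2 but need not be bounded, so
  \<open>plap_parts\<close> does not cover it directly. The formula is carried over from truncations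
  by dominated convergence on both sides: finite p-energies control the flux term, and
  \<open>v\<close> in L2 controls the other.\<close>

lemma Delta_p_imp_subdiff_F_p:
  assumes u: "u \<in> L2 nu" "integrable M (dens u)" and v: "v \<in> L2 nu" "AE x in nu. v x = plap u x"
  shows "(u, \<lambda>x. - v x) \<in> subdiff nu (F_p nu m B p)"
proof -
  have um[measurable]: "u \<in> borel_measurable nu" and vm[measurable]: "v \<in> borel_measurable nu"
    using u v by (auto intro: L2_measurable)
  have "enn2real (F_p nu m B p u) + (\<integral>x. - v x * (w x - u x) \<partial>nu) \<le> enn2real (F_p nu m B p w)"
    if w: "w \<in> L2 nu" "F_p nu m B p w < \<infinity>" for w
  proof -
    have wm[measurable]: "w \<in> borel_measurable nu" by (rule L2_measurable[OF w(1)])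
    have dw: "integrable M (dens w)" using w(2) F_p_finite_iff[OF wm] by blast
    define f where "f x = w x - u x" for x
    have fL: "f \<in> L2 nu" unfolding f_def by (intro L2_diff w u)
    have fm[measurable]: "f \<in> borel_measurable nu" by (rule L2_measurable[OF fL])
    have "dens (\<lambda>x. - u x) = dens u" using dens_cmult[of "-1" u] by auto
    then have "integrable M (dens (\<lambda>x. w x + - u x))"
      using u(2) by (intro dens_add_integrable dw) auto
    then have df: "integrable M (dens f)" by (simp add: f_def[abs_def])
    have ig: "integrable M (\<lambda>z. flux u z * grad f (fst z) (snd z))" by (rule flux_grad_integrable[OF um fm u(2) df])
    have lim: "(\<lambda>n. \<integral>z. flux u z * grad (\<lambda>x. clip (real n) (f x)) (fst z) (snd z) / 2 \<partial>M)
        \<longlonglongrightarrow> (\<integral>z. flux u z * grad f (fst z) (snd z) / 2 \<partial>M)"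
    proof (rule integral_dominated_convergence)
      show "integrable M (\<lambda>z. \<bar>flux u z * grad f (fst z) (snd z)\<bar>)" using ig by simp
      show "AE z in M. (\<lambda>n. flux u z * grad (\<lambda>x. clip (real n) (f x)) (fst z) (snd z) / 2)
          \<longlonglongrightarrow> flux u z * grad f (fst z) (snd z) / 2"
        unfolding grad_def by (intro AE_I2 tendsto_intros tendsto_clip) simp
      have half: "norm (c / 2) \<le> \<bar>c\<bar>" for c :: real by simp
      have le: "\<bar>flux u z * grad (\<lambda>x. clip (real n) (f x)) (fst z) (snd z)\<bar> \<le> \<bar>flux u z * grad f (fst z) (snd z)\<bar>" for n z
        unfolding abs_mult grad_def by (intro mult_left_mono abs_clip_diff_le) auto
      show "AE z in M. norm (flux u z * grad (\<lambda>x. clip (real n) (f x)) (fst z) (snd z) / 2)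
          \<le> \<bar>flux u z * grad f (fst z) (snd z)\<bar>" for n
        by (rule AE_I2) (rule order_trans[OF half le])
    qed measurable
    have eq: "(\<integral>z. flux u z * grad (\<lambda>x. clip (real n) (f x)) (fst z) (snd z) / 2 \<partial>M)
        = - (\<integral>x. v x * clip (real n) (f x) \<partial>nu)" for n
    proof -
      have "(\<integral>x. plap u x * clip (real n) (f x) \<partial>nu) = (\<integral>x. v x * clip (real n) (f x) \<partial>nu)"
        by (intro integral_cong_AE) (use v(2) in auto)
      then show ?thesis
        using plap_parts[OF um u(2) L2_clip[OF fL], of "real n" "real n"] by (simp add: abs_clip_le)
    qed
    have "(\<lambda>n. - (\<integral>x. v x * clip (real n) (f x) \<partial>nu)) \<longlonglongrightarrow> (\<integral>z. flux u z * grad f (fst z) (snd z) / 2 \<partial>M)"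
      using lim unfolding eq .
    moreover have "(\<lambda>n. - (\<integral>x. v x * clip (real n) (f x) \<partial>nu)) \<longlonglongrightarrow> - (\<integral>x. v x * f x \<partial>nu)"
      by (intro tendsto_minus tendsto_integral_clip L2_mult_integrable v fL vm fm)
    ultimately have parts_f: "(\<integral>z. flux u z * grad f (fst z) (snd z) / 2 \<partial>M) = - (\<integral>x. v x * f x \<partial>nu)"
      by (rule LIMSEQ_unique)
    have "(\<integral>z. dens u z / (2 * p) + flux u z * grad f (fst z) (snd z) / 2 \<partial>M) \<le> (\<integral>z. dens w z / (2 * p) \<partial>M)"
    proof (rule integral_mono)
      fix z
      have "grad f (fst z) (snd z) = grad w (fst z) (snd z) - grad u (fst z) (snd z)"
        by (simp add: grad_def f_def)
      then show "dens u z / (2 * p) + flux u z * grad f (fst z) (snd z) / 2 \<le> dens w z / (2 * p)"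
        using dens_subgradient[of u z w] by simp
    qed (use u(2) ig dw in auto)
    then show ?thesis
      using parts_f ig u(2) by (simp add: F_p_eq[OF um u(2)] F_p_eq[OF wm dw] f_def)
  qed
  then show ?thesis
    unfolding subdiff_iff using u L2_uminus[OF v(1)] F_p_finite_iff[OF um] by blast
qed

text \<open>A bounded perturbation of an \<open>L2\<close> function need not be \<open>L2\<close> when \<open>nu\<close> is infinite.
  The part of the flux with \<open>\<bar>grad u\<bar> \<le> 1\<close> is then dominated by \<open>\<bar>grad u\<bar>\<close> (as \<open>p \<ge> 2\<close>), and the
  other part has an integrable divergence, whose large values must be compensated by \<open>L2\<close> terms.\<close>

lemma plap_L2_of_bounded_add:
  assumes u: "u \<in> L2 nu" "integrable M (dens u)" and v: "v \<in> L2 nu"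
    and bd: "AE x in nu. \<bar>v x + plap u x\<bar> \<le> 1"
  shows "plap u \<in> L2 nu"
proof -
  have um[measurable]: "u \<in> borel_measurable nu" and vm[measurable]: "v \<in> borel_measurable nu"
    using u v by (auto intro: L2_measurable)
  have pm[measurable]: "plap u \<in> borel_measurable nu" by (rule plap_measurable[OF um])
  have sq2: "(a + b)\<^sup>2 \<le> 2 * a\<^sup>2 + 2 * b\<^sup>2" for a b :: real
    using zero_le_power2[of "a - b"] by (simp add: power2_eq_square algebra_simps)
  show ?thesis
  proof (cases "emeasure nu (space nu) < \<infinity>")
    case True
    then interpret finite_measure nu by (intro finite_measureI) simp
    have "integrable nu (\<lambda>x. (plap u x)\<^sup>2)"
    proof (rule Bochner_Integration.integrable_bound)
      show "integrable nu (\<lambda>x. 2 * (v x)\<^sup>2 + 2)" using L2_integrable[OF v] by simp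
      show "AE x in nu. norm ((plap u x)\<^sup>2) \<le> norm (2 * (v x)\<^sup>2 + 2)"
        using bd
      proof eventually_elim
        case (elim x)
        have "(v x + plap u x)\<^sup>2 \<le> 1\<^sup>2" using elim by (subst abs_le_square_iff[symmetric]) simp
        then show ?case using sq2[of "- v x" "v x + plap u x"] by (simp add: abs_of_nonneg)
      qed
    qed measurable
    then show ?thesis by (simp add: L2_def)
  next
    case False
    then have p2: "p \<ge> 2" using finite_or_p_ge_2 by auto
    define Gs where "Gs z = (if \<bar>grad u (fst z) (snd z)\<bar> \<le> 1 then flux u z else 0)" for z
    define Gl where "Gl z = (if \<bar>grad u (fst z) (snd z)\<bar> \<le> 1 then 0 else flux u z)" for z
    have Gsm[measurable]: "Gs \<in> borel_measurable (nu \<Otimes>\<^sub>M nu)" unfolding Gs_def[abs_def] by measurable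
    have Glm[measurable]: "Gl \<in> borel_measurable (nu \<Otimes>\<^sub>M nu)" unfolding Gl_def[abs_def] by measurable
    have Gs_le: "\<bar>Gs z\<bar> \<le> \<bar>grad u (fst z) (snd z)\<bar>" for z
    proof (cases "\<bar>grad u (fst z) (snd z)\<bar> \<le> 1")
      case True
      have "\<bar>flux u z\<bar> \<le> 1 * \<bar>grad u (fst z) (snd z)\<bar> powr (p - 1)"
        unfolding flux_def abs_mult abs_signed_pow
        by (intro mult_right_mono) (auto simp: abs_of_nonneg Kker_nonneg Kker_le_1)
      also have "\<dots> \<le> \<bar>grad u (fst z) (snd z)\<bar> powr 1"
      proof (cases "grad u (fst z) (snd z) = 0")
        case False
        have "\<bar>grad u (fst z) (snd z)\<bar> powr (p - 1) \<le> \<bar>grad u (fst z) (snd z)\<bar> powr 1"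
          using True False p2 by (intro powr_mono') auto
        then show ?thesis by simp
      qed simp
      finally show ?thesis using True by (simp add: Gs_def)
    qed (simp add: Gs_def)
    have "(\<lambda>z. grad u (fst z) (snd z)) \<in> L2 M" by (rule L2_nu_m_grad[OF u(1)])
    then have "Gs \<in> L2 M" by (rule L2_bound) (auto simp: Gs_le measurable_nu_m_iff)
    then have Gs2: "integrable M (\<lambda>z. (Gs z)\<^sup>2)" by (rule L2_integrable)
    define Vs where "Vs x = (\<integral>y. Gs (x, y) \<partial>(m x))" for x
    define Vl where "Vl x = (\<integral>y. Gl (x, y) \<partial>(m x))" for x
    have VsL: "Vs \<in> L2 nu" unfolding Vs_def[abs_def] by (rule L2_kernel_integral[OF Gsm Gs2])
    have Gli: "integrable M Gl"
    proof (rule Bochner_Integration.integrable_bound[OF u(2)])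
      have "\<bar>Gl z\<bar> \<le> dens u z" for z
      proof (cases "\<bar>grad u (fst z) (snd z)\<bar> \<le> 1")
        case False
        then have "\<bar>grad u (fst z) (snd z)\<bar> powr (p - 1) \<le> \<bar>grad u (fst z) (snd z)\<bar> powr p"
          by (intro powr_mono) auto
        then show ?thesis using False
          by (simp add: Gl_def flux_def dens_def abs_mult abs_signed_pow Kker_nonneg abs_of_nonneg mult_left_mono)
      qed (simp add: Gl_def dens_nonneg)
      then show "AE z in M. norm (Gl z) \<le> norm (dens u z)" by (auto simp: abs_of_nonneg dens_nonneg)
    qed measurable
    have Vli: "integrable nu Vl" unfolding Vl_def[abs_def] by (rule integrable_nu_m_Fubini[OF Gli])
    have Vlm[measurable]: "Vl \<in> borel_measurable nu" using Vli by simp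
    have split: "AE x in nu. plap u x = Vs x + Vl x"
      using AE_integrable_of_square[OF Gsm Gs2] AE_nu_m_section[OF Gli]
    proof eventually_elim
      case (elim x)
      have "plap u x = (\<integral>y. Gs (x, y) + Gl (x, y) \<partial>(m x))"
        unfolding plap_def by (intro Bochner_Integration.integral_cong) (auto simp: Gs_def Gl_def)
      then show ?case using elim by (simp add: Vs_def Vl_def)
    qed
    define r where "r x = v x + Vs x" for x
    have rL: "r \<in> L2 nu" unfolding r_def[abs_def] by (rule L2_add[OF v VsL])
    have "integrable nu (\<lambda>x. (plap u x)\<^sup>2)"
    proof (rule Bochner_Integration.integrable_bound)
      show "integrable nu (\<lambda>x. 2 * (Vs x)\<^sup>2 + (4 * \<bar>Vl x\<bar> + 8 * (r x)\<^sup>2))"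
        using L2_integrable[OF VsL] L2_integrable[OF rL] Vli by simp
      show "AE x in nu. norm ((plap u x)\<^sup>2) \<le> norm (2 * (Vs x)\<^sup>2 + (4 * \<bar>Vl x\<bar> + 8 * (r x)\<^sup>2))"
        using split bd
      proof eventually_elim
        case (elim x)
        have rV: "\<bar>r x + Vl x\<bar> \<le> 1" using elim by (simp add: r_def add.assoc)
        \<comment> \<open>For \<open>\<bar>Vl x\<bar> > 2\<close> the bound
          \<open>\<bar>r x + Vl x\<bar> \<le> 1\<close> gives \<open>\<bar>r x\<bar> \<ge> \<bar>Vl
          x\<bar> - 1 \<ge> \<bar>Vl x\<bar> / 2\<close>; below the threshold one factor of the
          square is at most 2, and integrability of \<open>Vl\<close> suffices.\<close>
        have "(Vl x)\<^sup>2 \<le> 2 * \<bar>Vl x\<bar> + 4 * (r x)\<^sup>2"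
        proof (cases "\<bar>Vl x\<bar> \<le> 2")
          case True
          then have "\<bar>Vl x\<bar> * \<bar>Vl x\<bar> \<le> 2 * \<bar>Vl x\<bar>" by (intro mult_right_mono) auto
          then have "(Vl x)\<^sup>2 \<le> 2 * \<bar>Vl x\<bar>" by (simp add: power2_eq_square)
          then show ?thesis using zero_le_power2[of "r x"] by linarith
        next
          case False
          then have "\<bar>Vl x\<bar> \<le> \<bar>2 * r x\<bar>" using rV by (simp add: abs_if split: if_splits)
          then have "(Vl x)\<^sup>2 \<le> (2 * r x)\<^sup>2" by (rule abs_le_square_iff[THEN iffD1])
          then show ?thesis by (simp add: power_mult_distrib)
        qed
        then have "(plap u x)\<^sup>2 \<le> 2 * (Vs x)\<^sup>2 + (4 * \<bar>Vl x\<bar> + 8 * (r x)\<^sup>2)"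
          using sq2[of "Vs x" "Vl x"] elim(1) by simp
        then show ?case by (simp add: abs_of_nonneg)
      qed
    qed measurable
    then show ?thesis by (simp add: L2_def)
  qed
qed

lemma op_neg_Delta_p: "op_neg (Delta_p nu m B p) = subdiff nu (F_p nu m B p)"
proof -
  have "(u, v) \<in> op_neg (Delta_p nu m B p) \<longleftrightarrow> (u, v) \<in> subdiff nu (F_p nu m B p)" for u v
  proof
    assume "(u, v) \<in> op_neg (Delta_p nu m B p)"
    then have "(u, \<lambda>x. - (- v x)) \<in> subdiff nu (F_p nu m B p)"
      unfolding op_neg_iff Delta_p_iff using Delta_p_imp_subdiff_F_p by blast
    then show "(u, v) \<in> subdiff nu (F_p nu m B p)" by simp
  next
    assume "(u, v) \<in> subdiff nu (F_p nu m B p)"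
    then show "(u, v) \<in> op_neg (Delta_p nu m B p)"
      unfolding op_neg_iff by (rule subdiff_F_p_imp_Delta_p)
  qed
  then show ?thesis by (intro equalityI subrelI) blast+
qed

end

section \<open>The total variation term and the sum\<close>

text \<open>The lower cutoff makes \<open>E n\<close> a set of finite measure, by Chebyshev's
  inequality, and the upper one makes \<open>w\<close> bounded on it; the bands exhaust the set
  where \<open>w\<close> is nonzero.\<close>

lemma L2_truncate:
  fixes w :: "'a \<Rightarrow> real"
  assumes w: "w \<in> L2 nu"
  defines "E \<equiv> \<lambda>n. {x \<in> space nu. 1 / real (Suc n) \<le> \<bar>w x\<bar> \<and> \<bar>w x\<bar> \<le> real (Suc n)}"
  shows "E n \<in> sets nu" "emeasure nu (E n) < \<infinity>"
    "(\<lambda>n. \<integral>x. (w x - w x * indicator (E n) x)\<^sup>2 \<partial>nu) \<longlonglongrightarrow> 0"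
proof -
  have [measurable]: "w \<in> borel_measurable nu" by (rule L2_measurable[OF w])
  have E[measurable]: "E n \<in> sets nu" for n unfolding E_def by measurable
  show "E n \<in> sets nu" by (rule E)
  have "integrable nu (indicator (E n) :: 'a \<Rightarrow> real)"
  proof (rule Bochner_Integration.integrable_bound)
    show "integrable nu (\<lambda>x. (real (Suc n))\<^sup>2 * (w x)\<^sup>2)" using L2_integrable[OF w] by simp
    have "(indicator (E n) x :: real) \<le> (real (Suc n))\<^sup>2 * (w x)\<^sup>2" for x
    proof (cases "x \<in> E n")
      case True
      then have "1 \<le> real (Suc n) * \<bar>w x\<bar>" by (simp add: E_def field_simps)
      then have "1\<^sup>2 \<le> (real (Suc n) * \<bar>w x\<bar>)\<^sup>2" by (intro power_mono) auto
      then show ?thesis using True by (simp add: power_mult_distrib)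
    qed simp
    then show "AE x in nu. norm (indicator (E n) x :: real) \<le> norm ((real (Suc n))\<^sup>2 * (w x)\<^sup>2)"
      by (auto simp: abs_of_nonneg)
  qed measurable
  then show "emeasure nu (E n) < \<infinity>"
    using sets.sets_into_space[OF E] by (simp add: integrable_indicator_iff Int_absorb2)
  have "(\<lambda>n. \<integral>x. (w x - w x * indicator (E n) x)\<^sup>2 \<partial>nu) \<longlonglongrightarrow> (\<integral>x. 0 \<partial>nu)"
  proof (rule integral_dominated_convergence)
    show "integrable nu (\<lambda>x. (w x)\<^sup>2)" by (rule L2_integrable[OF w])
    show "AE x in nu. norm ((w x - w x * indicator (E n) x)\<^sup>2) \<le> (w x)\<^sup>2" for n
      by (auto simp: indicator_def)
    have "(\<lambda>n. (w x - w x * indicator (E n) x)\<^sup>2) \<longlonglongrightarrow> 0" if x: "x \<in> space nu" for x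
    proof (cases "w x = 0")
      case False
      have "\<forall>\<^sub>F n in sequentially. inverse (real (Suc n)) < \<bar>w x\<bar>"
        using False LIMSEQ_inverse_real_of_nat by (intro order_tendstoD) auto
      moreover have "\<forall>\<^sub>F n in sequentially. nat \<lceil>\<bar>w x\<bar>\<rceil> \<le> n" by (rule eventually_ge_at_top)
      ultimately have "\<forall>\<^sub>F n in sequentially. (w x - w x * indicator (E n) x)\<^sup>2 = 0"
      proof eventually_elim
        case (elim n)
        have "\<bar>w x\<bar> \<le> real n" using elim(2) by linarith
        then have "x \<in> E n" using elim(1) x by (simp add: E_def inverse_eq_divide)
        then show ?case by simp
      qed
      then show ?thesis by (rule tendsto_eventually)
    qed simp
    then show "AE x in nu. (\<lambda>n. (w x - w x * indicator (E n) x)\<^sup>2) \<longlonglongrightarrow> 0" by simp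
  qed measurable
  then show "(\<lambda>n. \<integral>x. (w x - w x * indicator (E n) x)\<^sup>2 \<partial>nu) \<longlonglongrightarrow> 0" by simp
qed

locale energy_walk = p_laplace_walk nu m B p
  for nu :: "'a measure" and m :: "'a \<Rightarrow> 'a measure" and B :: "'a \<Rightarrow> 'a set" and p :: real +
  fixes A :: "'a \<Rightarrow> 'a set"
  assumes A_meas: "{(x, y). x \<in> space nu \<and> y \<in> A x} \<in> sets (nu \<Otimes>\<^sub>M nu)"
begin

definition tv :: "('a \<Rightarrow> real) \<Rightarrow> 'a \<times> 'a \<Rightarrow> real" where
  "tv u z = \<bar>grad u (fst z) (snd z)\<bar> * Kker A (fst z) (snd z) / 2"

lemma KA_measurable [measurable]: "(\<lambda>z. Kker A (fst z) (snd z)) \<in> borel_measurable (nu \<Otimes>\<^sub>M nu)"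
  by (rule borel_measurable_Kker[OF A_meas])

lemma tv_measurable [measurable]: "u \<in> borel_measurable nu \<Longrightarrow> tv u \<in> borel_measurable (nu \<Otimes>\<^sub>M nu)"
  unfolding tv_def[abs_def]
  by (intro borel_measurable_divide borel_measurable_times borel_measurable_abs borel_measurable_grad
      KA_measurable borel_measurable_const)

lemma tv_nonneg: "0 \<le> tv u z"
  by (simp add: tv_def Kker_nonneg)

lemma F_1_tv: "F_1 nu m A u = (\<integral>\<^sup>+ z. ennreal (tv u z) \<partial>M)"
  by (simp add: F_1_def tv_def)

lemma F_1_finite_iff:
  assumes [measurable]: "u \<in> borel_measurable nu"
  shows "F_1 nu m A u < \<infinity> \<longleftrightarrow> integrable M (tv u)"
  unfolding F_1_tv integrable_iff_bounded by (simp add: tv_nonneg)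

lemma F_1_eq:
  assumes [measurable]: "u \<in> borel_measurable nu" and "integrable M (tv u)"
  shows "enn2real (F_1 nu m A u) = (\<integral>z. tv u z \<partial>M)"
  using assms(2) unfolding F_1_tv by (simp add: nn_integral_eq_integral tv_nonneg integral_nonneg_AE)

lemma F_1_convex:
  assumes [measurable]: "u \<in> borel_measurable nu" "f \<in> borel_measurable nu" and t: "0 \<le> t" "t \<le> 1"
  shows "F_1 nu m A (\<lambda>x. u x + t * f x) \<le> ennreal (1 - t) * F_1 nu m A u + ennreal t * F_1 nu m A (\<lambda>x. u x + f x)"
proof -
  have "tv (\<lambda>x. u x + t * f x) z \<le> (1 - t) * tv u z + t * tv (\<lambda>x. u x + f x) z" for z
  proof -
    have "grad (\<lambda>x. u x + t * f x) (fst z) (snd z)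
        = (1 - t) * grad u (fst z) (snd z) + t * grad (\<lambda>x. u x + f x) (fst z) (snd z)"
      by (simp add: grad_def algebra_simps)
    then have "\<bar>grad (\<lambda>x. u x + t * f x) (fst z) (snd z)\<bar>
        \<le> (1 - t) * \<bar>grad u (fst z) (snd z)\<bar> + t * \<bar>grad (\<lambda>x. u x + f x) (fst z) (snd z)\<bar>"
      using t by (simp add: abs_mult order_trans[OF abs_triangle_ineq])
    from mult_right_mono[OF this, of "Kker A (fst z) (snd z) / 2"] show ?thesis
      by (simp add: tv_def algebra_simps Kker_nonneg diff_divide_distrib add_divide_distrib)
  qed
  then have "F_1 nu m A (\<lambda>x. u x + t * f x)
      \<le> (\<integral>\<^sup>+ z. ennreal (1 - t) * ennreal (tv u z) + ennreal t * ennreal (tv (\<lambda>x. u x + f x) z) \<partial>M)"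
    unfolding F_1_tv using t tv_nonneg
    by (intro nn_integral_mono) (simp add: ennreal_mult[symmetric] ennreal_plus[symmetric] del: ennreal_plus)
  also have "\<dots> = ennreal (1 - t) * F_1 nu m A u + ennreal t * F_1 nu m A (\<lambda>x. u x + f x)"
    unfolding F_1_tv by (simp add: nn_integral_add nn_integral_cmult)
  finally show ?thesis .
qed

text \<open>A perturbation \<open>f\<close> costs at most
  \<open>(\<bar>f (fst z)\<bar> + \<bar>f (snd z)\<bar>) / 2\<close> at each pair, and both
  marginals of \<open>M\<close> are \<open>nu\<close>; so the L1 norm of \<open>f\<close> appears
  with constant 1.\<close>

lemma
  assumes [measurable]: "u \<in> borel_measurable nu" and tu: "integrable M (tv u)" and f: "integrable nu f"
  shows tv_add_integrable: "integrable M (tv (\<lambda>x. u x + f x))"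
    and tv_add_le: "(\<integral>z. tv (\<lambda>x. u x + f x) z \<partial>M) \<le> (\<integral>z. tv u z \<partial>M) + (\<integral>x. \<bar>f x\<bar> \<partial>nu)"
proof -
  have [measurable]: "f \<in> borel_measurable nu" using f by simp
  have fa: "integrable nu (\<lambda>x. \<bar>f x\<bar>)" using f by simp
  have le: "tv (\<lambda>x. u x + f x) z \<le> tv u z + (\<bar>f (fst z)\<bar> + \<bar>f (snd z)\<bar>) / 2" for z
  proof -
    define K where "K = Kker A (fst z) (snd z)"
    define s where "s = \<bar>f (fst z)\<bar> + \<bar>f (snd z)\<bar>"
    have "\<bar>grad (\<lambda>x. u x + f x) (fst z) (snd z)\<bar> * K \<le> (\<bar>grad u (fst z) (snd z)\<bar> + s) * K"
      unfolding K_def s_def by (intro mult_right_mono Kker_nonneg) (simp add: grad_def)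
    moreover have "s * K \<le> s * 1"
      unfolding K_def s_def by (intro mult_left_mono Kker_le_1) simp
    ultimately have "\<bar>grad (\<lambda>x. u x + f x) (fst z) (snd z)\<bar> * K \<le> \<bar>grad u (fst z) (snd z)\<bar> * K + s"
      by (simp add: distrib_right)
    then show ?thesis unfolding tv_def K_def[symmetric] s_def[symmetric] by simp
  qed
  have i: "integrable M (\<lambda>z. tv u z + (\<bar>f (fst z)\<bar> + \<bar>f (snd z)\<bar>) / 2)"
    using tu integrable_nu_m_fst[OF fa] integrable_nu_m_snd[OF fa] by simp
  show j: "integrable M (tv (\<lambda>x. u x + f x))"
  proof (rule Bochner_Integration.integrable_bound[OF i])
    show "AE z in M. norm (tv (\<lambda>x. u x + f x) z) \<le> norm (tv u z + (\<bar>f (fst z)\<bar> + \<bar>f (snd z)\<bar>) / 2)"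
      using le by (auto simp: abs_of_nonneg tv_nonneg)
  qed measurable
  have s: "(\<integral>z. \<bar>f (fst z)\<bar> \<partial>M) = (\<integral>x. \<bar>f x\<bar> \<partial>nu)"
    using integral_nu_m_Fubini[OF integrable_nu_m_fst[OF fa]]
    by (simp add: prob_space.prob_space[OF prob_space_m] cong: Bochner_Integration.integral_cong)
  have s': "(\<integral>z. \<bar>f (snd z)\<bar> \<partial>M) = (\<integral>x. \<bar>f x\<bar> \<partial>nu)"
    using integral_nu_m_swap[of "\<lambda>z. \<bar>f (fst z)\<bar>"] s by simp
  have "(\<integral>z. tv (\<lambda>x. u x + f x) z \<partial>M) \<le> (\<integral>z. tv u z + (\<bar>f (fst z)\<bar> + \<bar>f (snd z)\<bar>) / 2 \<partial>M)"
    by (rule integral_mono[OF j i le])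
  also have "\<dots> = (\<integral>z. tv u z \<partial>M) + (\<integral>x. \<bar>f x\<bar> \<partial>nu)"
    using tu integrable_nu_m_fst[OF fa] integrable_nu_m_snd[OF fa] by (simp add: s s')
  finally show "(\<integral>z. tv (\<lambda>x. u x + f x) z \<partial>M) \<le> (\<integral>z. tv u z \<partial>M) + (\<integral>x. \<bar>f x\<bar> \<partial>nu)" .
qed

lemma AE_total_variation_part_bounded:
  assumes uv: "(u, v) \<in> subdiff nu (\<lambda>u. F_1 nu m A u + F_p nu m B p u)"
  shows "AE x in nu. \<bar>v x + plap u x\<bar> \<le> 1"
proof -
  have L: "u \<in> L2 nu" "v \<in> L2 nu" and fin: "F_1 nu m A u + F_p nu m B p u < \<infinity>"
    using uv unfolding subdiff_iff by blast+
  have um: "u \<in> borel_measurable nu" by (rule L2_measurable[OF L(1)])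
  have du: "integrable M (dens u)" using fin F_p_finite_iff[OF um] by simp
  have tu: "integrable M (tv u)" using fin F_1_finite_iff[OF um] by simp
  show ?thesis
  proof (rule AE_abs_add_plap_le[OF um du L(2)])
    fix f assume f: "f \<in> L2 nu" "\<And>x. \<bar>f x\<bar> \<le> 1" and fi: "integrable nu f"
    have fm: "f \<in> borel_measurable nu" by (rule L2_measurable[OF f(1)])
    have ufm: "(\<lambda>x. u x + f x) \<in> borel_measurable nu" using um fm by measurable
    have tuf: "integrable M (tv (\<lambda>x. u x + f x))" by (rule tv_add_integrable[OF um tu fi])
    have Hf: "F_1 nu m A (\<lambda>x. u x + f x) < \<infinity>" using tuf F_1_finite_iff[OF ufm] by blast
    have "(\<integral>x. v x * f x \<partial>nu) \<le> enn2real (F_1 nu m A (\<lambda>x. u x + f x)) - enn2real (F_1 nu m A u) - (\<integral>x. plap u x * f x \<partial>nu)"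
      by (rule subdiff_sum_variation[OF uv f Hf F_1_convex[OF um fm]])
    then show "(\<integral>x. v x * f x \<partial>nu) \<le> 1 * (\<integral>x. \<bar>f x\<bar> \<partial>nu) - (\<integral>x. plap u x * f x \<partial>nu)"
      using tv_add_le[OF um tu fi] by (simp add: F_1_eq[OF um tu] F_1_eq[OF ufm tuf])
  qed
qed

text \<open>For bounded \<open>f\<close> the variation inequality is already the subgradient
  inequality of \<open>F_1\<close> with competitor \<open>u + f\<close>. A general \<open>w\<close>
  is reached along truncations of \<open>w - u\<close>, a route that asks for finiteness of
  \<open>F_1 w\<close> but allows \<open>F_p w\<close> to be infinite.\<close>

lemma subdiff_sum_split:
  assumes uv: "(u, v) \<in> subdiff nu (\<lambda>u. F_1 nu m A u + F_p nu m B p u)"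
  shows "(u, \<lambda>x. v x + plap u x) \<in> subdiff nu (F_1 nu m A)"
    and "(u, \<lambda>x. - plap u x) \<in> subdiff nu (F_p nu m B p)"
proof -
  have L: "u \<in> L2 nu" "v \<in> L2 nu" and fin: "F_1 nu m A u + F_p nu m B p u < \<infinity>"
    using uv unfolding subdiff_iff by blast+
  have um[measurable]: "u \<in> borel_measurable nu" by (rule L2_measurable[OF L(1)])
  have du: "integrable M (dens u)" using fin F_p_finite_iff[OF um] by simp
  have F1u: "F_1 nu m A u < \<infinity>" using fin by simp
  have tu: "integrable M (tv u)" using F1u F_1_finite_iff[OF um] by simp
  have pL: "plap u \<in> L2 nu"
    by (rule plap_L2_of_bounded_add[OF L(1) du L(2) AE_total_variation_part_bounded[OF uv]])
  show "(u, \<lambda>x. - plap u x) \<in> subdiff nu (F_p nu m B p)"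
    by (rule Delta_p_imp_subdiff_F_p[OF L(1) du pL]) simp
  define V where "V x = v x + plap u x" for x
  have VL: "V \<in> L2 nu" unfolding V_def[abs_def] by (rule L2_add[OF L(2) pL])
  have "enn2real (F_1 nu m A u) + (\<integral>x. V x * (w x - u x) \<partial>nu) \<le> enn2real (F_1 nu m A w)"
    if w: "w \<in> L2 nu" "F_1 nu m A w < \<infinity>" for w
  proof -
    have wm[measurable]: "w \<in> borel_measurable nu" by (rule L2_measurable[OF w(1)])
    have tw: "integrable M (tv w)" using w(2) F_1_finite_iff[OF wm] by simp
    define f where "f x = w x - u x" for x
    have fL: "f \<in> L2 nu" unfolding f_def by (intro L2_diff w L)
    have fm[measurable]: "f \<in> borel_measurable nu" by (rule L2_measurable[OF fL])
    define fn where "fn n x = clip (real n) (f x)" for n x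
    have fnL: "fn n \<in> L2 nu" for n unfolding fn_def[abs_def] by (rule L2_clip[OF fL]) simp
    have fnm[measurable]: "fn n \<in> borel_measurable nu" for n by (rule L2_measurable[OF fnL])
    have fnb: "\<bar>fn n x\<bar> \<le> real n" for n x by (simp add: fn_def abs_clip_le)
    have wnm[measurable]: "(\<lambda>x. u x + fn n x) \<in> borel_measurable nu" for n by measurable
    \<comment> \<open>The gradient of the truncated difference is at most the distance between the
      gradients of \<open>w\<close> and \<open>u\<close>, which bounds the density uniformly in
      \<open>n\<close>.\<close>
    have tvn: "tv (\<lambda>x. u x + fn n x) z \<le> 2 * tv u z + tv w z" for n z
    proof -
      have tri: "\<bar>b\<bar> \<le> \<bar>c - a\<bar> \<Longrightarrow> \<bar>a + b\<bar> \<le> 2 * \<bar>a\<bar> + \<bar>c\<bar>" for a b c :: real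
        by arith
      have "\<bar>fn n (snd z) - fn n (fst z)\<bar> \<le> \<bar>f (snd z) - f (fst z)\<bar>"
        unfolding fn_def by (rule abs_clip_diff_le) simp
      then have "\<bar>grad (\<lambda>x. u x + fn n x) (fst z) (snd z)\<bar> \<le> 2 * \<bar>grad u (fst z) (snd z)\<bar> + \<bar>grad w (fst z) (snd z)\<bar>"
        using tri[of "fn n (snd z) - fn n (fst z)" "w (snd z) - w (fst z)" "u (snd z) - u (fst z)"]
        unfolding grad_def f_def by (simp add: algebra_simps)
      from mult_right_mono[OF this, of "Kker A (fst z) (snd z) / 2"] show ?thesis
        by (simp add: tv_def algebra_simps Kker_nonneg add_divide_distrib)
    qed
    have dom: "integrable M (\<lambda>z. 2 * tv u z + tv w z)" using tu tw by simp
    have AEle: "AE z in M. norm (tv (\<lambda>x. u x + fn n x) z) \<le> 2 * tv u z + tv w z" for n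
      using tvn by (auto simp: tv_nonneg)
    have lim: "(\<lambda>n. tv (\<lambda>x. u x + fn n x) z) \<longlonglongrightarrow> tv w z" for z
    proof -
      have tvw: "tv w z = \<bar>(u (snd z) + f (snd z)) - (u (fst z) + f (fst z))\<bar> * Kker A (fst z) (snd z) / 2"
        by (simp add: tv_def grad_def f_def)
      have "(\<lambda>n. \<bar>(u (snd z) + fn n (snd z)) - (u (fst z) + fn n (fst z))\<bar> * Kker A (fst z) (snd z) / 2)
          \<longlonglongrightarrow> \<bar>(u (snd z) + f (snd z)) - (u (fst z) + f (fst z))\<bar> * Kker A (fst z) (snd z) / 2"
        unfolding fn_def by (intro tendsto_intros tendsto_clip) simp
      then show ?thesis unfolding tvw by (simp add: tv_def grad_def)
    qed
    have tn: "integrable M (tv (\<lambda>x. u x + fn n x))" for n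
    proof (rule Bochner_Integration.integrable_bound[OF dom])
      show "AE z in M. norm (tv (\<lambda>x. u x + fn n x) z) \<le> norm (2 * tv u z + tv w z)"
        using AEle[of n] by eventually_elim simp
    qed measurable
    have ineq: "(\<integral>x. V x * fn n x \<partial>nu) \<le> (\<integral>z. tv (\<lambda>x. u x + fn n x) z \<partial>M) - (\<integral>z. tv u z \<partial>M)" for n
    proof -
      have "F_1 nu m A (\<lambda>x. u x + fn n x) < \<infinity>" using tn F_1_finite_iff[OF wnm] by blast
      from subdiff_sum_variation[OF uv fnL fnb this F_1_convex[OF um fnm]]
      have "(\<integral>x. v x * fn n x \<partial>nu) + (\<integral>x. plap u x * fn n x \<partial>nu)
          \<le> (\<integral>z. tv (\<lambda>x. u x + fn n x) z \<partial>M) - (\<integral>z. tv u z \<partial>M)"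
        by (simp add: F_1_eq[OF um tu] F_1_eq[OF wnm tn])
      moreover have "(\<integral>x. V x * fn n x \<partial>nu) = (\<integral>x. v x * fn n x \<partial>nu) + (\<integral>x. plap u x * fn n x \<partial>nu)"
        unfolding V_def distrib_right
        by (rule Bochner_Integration.integral_add[OF L2_mult_integrable[OF L(2) fnL] L2_mult_integrable[OF pL fnL]])
      ultimately show ?thesis by simp
    qed
    have "(\<lambda>n. \<integral>z. tv (\<lambda>x. u x + fn n x) z \<partial>M) \<longlonglongrightarrow> (\<integral>z. tv w z \<partial>M)"
      by (rule integral_dominated_convergence[OF _ _ dom _ AEle]) (use lim in auto)
    then have lim1: "(\<lambda>n. (\<integral>z. tv (\<lambda>x. u x + fn n x) z \<partial>M) - (\<integral>z. tv u z \<partial>M)) \<longlonglongrightarrow> (\<integral>z. tv w z \<partial>M) - (\<integral>z. tv u z \<partial>M)"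
      by (intro tendsto_diff tendsto_const)
    have lim2: "(\<lambda>n. \<integral>x. V x * fn n x \<partial>nu) \<longlonglongrightarrow> (\<integral>x. V x * f x \<partial>nu)"
      unfolding fn_def by (rule tendsto_integral_clip[OF L2_mult_integrable[OF VL fL] L2_measurable[OF VL] fm])
    have "(\<integral>x. V x * f x \<partial>nu) \<le> (\<integral>z. tv w z \<partial>M) - (\<integral>z. tv u z \<partial>M)"
      by (rule LIMSEQ_le[OF lim2 lim1]) (use ineq in auto)
    then show ?thesis by (simp add: F_1_eq[OF um tu] F_1_eq[OF wm tw] f_def)
  qed
  then show "(u, \<lambda>x. v x + plap u x) \<in> subdiff nu (F_1 nu m A)"
    unfolding V_def[symmetric] subdiff_iff using L(1) VL F1u by blast
qed

lemma subdiff_sum: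
  "subdiff nu (\<lambda>u. F_1 nu m A u + F_p nu m B p u) = op_sum (subdiff nu (F_1 nu m A)) (subdiff nu (F_p nu m B p))"
proof (intro equalityI subrelI)
  fix u v assume uv: "(u, v) \<in> subdiff nu (\<lambda>u. F_1 nu m A u + F_p nu m B p u)"
  have "v = (\<lambda>x. (v x + plap u x) + - plap u x)" by simp
  then show "(u, v) \<in> op_sum (subdiff nu (F_1 nu m A)) (subdiff nu (F_p nu m B p))"
    unfolding op_sum_def using subdiff_sum_split[OF uv]
    by (intro CollectI exI[of _ u] exI[of _ "\<lambda>x. v x + plap u x"] exI[of _ "\<lambda>x. - plap u x"] conjI) simp_all
next
  fix u v assume "(u, v) \<in> op_sum (subdiff nu (F_1 nu m A)) (subdiff nu (F_p nu m B p))"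
  then obtain v1 v2 where v: "v = (\<lambda>x. v1 x + v2 x)"
    and s: "(u, v1) \<in> subdiff nu (F_1 nu m A)" "(u, v2) \<in> subdiff nu (F_p nu m B p)"
    unfolding op_sum_def by blast
  show "(u, v) \<in> subdiff nu (\<lambda>u. F_1 nu m A u + F_p nu m B p u)"
    unfolding v by (rule subdiff_add[OF s])
qed

section \<open>Complete accretivity and density of the domain\<close>

lemma completely_accretive_sum:
  "completely_accretive nu (subdiff nu (\<lambda>u. F_1 nu m A u + F_p nu m B p u))"
proof (rule completely_accretive_subdiff)
  fix u1 u2 R assume L: "u1 \<in> L2 nu" "u2 \<in> L2 nu" and R: "mono_contraction R"
  have um: "u1 \<in> borel_measurable nu" "u2 \<in> borel_measurable nu" using L by (auto intro: L2_measurable)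
  let ?w1 = "\<lambda>x. u1 x - R (u1 x - u2 x)" and ?w2 = "\<lambda>x. u2 x + R (u1 x - u2 x)"
  have "convex_on UNIV (\<lambda>a::real. \<bar>a\<bar>)"
    by (rule convex_on_subgradients[OF abs_subgradient])
  then have 1: "F_1 nu m A ?w1 + F_1 nu m A ?w2 \<le> F_1 nu m A u1 + F_1 nu m A u2"
    using energy_exchange[of "\<lambda>a. \<bar>a\<bar>" "\<lambda>z. Kker A (fst z) (snd z) / 2", OF _ _ _ _ um R]
    by (simp add: F_1_def Kker_nonneg)
  have "(\<lambda>z. Kker B (fst z) (snd z) / (2 * p)) \<in> borel_measurable (nu \<Otimes>\<^sub>M nu)" by measurable
  then have 2: "F_p nu m B p ?w1 + F_p nu m B p ?w2 \<le> F_p nu m B p u1 + F_p nu m B p u2"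
    using energy_exchange[of "\<lambda>a. \<bar>a\<bar> powr p" "\<lambda>z. Kker B (fst z) (snd z) / (2 * p)", OF convex_on_abs_powr[OF p] _ _ _ um R] p
    by (simp add: F_p_def Kker_nonneg)
  show "F_1 nu m A ?w1 + F_p nu m B p ?w1 + (F_1 nu m A ?w2 + F_p nu m B p ?w2)
      \<le> F_1 nu m A u1 + F_p nu m B p u1 + (F_1 nu m A u2 + F_p nu m B p u2)"
    using add_mono[OF 1 2] by (simp add: ac_simps)
qed

text \<open>\<open>G\<close> selects a subgradient of both integrands at every pair, with
  \<open>sgn 0 = 0\<close> preserving antisymmetry. As \<open>G\<close> lies in L2 of
  \<open>M\<close>, integration by parts works for every L2 direction without truncation, and minus
  the \<open>m x\<close>-mean of \<open>G\<close> is a subgradient.\<close>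

lemma bounded_finite_support_in_domain:
  assumes u: "u \<in> borel_measurable nu" "\<And>x. \<bar>u x\<bar> \<le> k"
    and E: "E \<in> sets nu" "emeasure nu E < \<infinity>" "\<And>x. x \<notin> E \<Longrightarrow> u x = 0"
  shows "u \<in> op_dom (subdiff nu (\<lambda>u. F_1 nu m A u + F_p nu m B p u))"
proof -
  have um[measurable]: "u \<in> borel_measurable nu" by fact
  have [measurable]: "E \<in> sets nu" by fact
  have k: "k \<ge> 0" using u(2)[of undefined] by linarith
  have EL: "(indicator E :: 'a \<Rightarrow> real) \<in> L2 nu" by (rule L2_indicator[OF E(1,2)])
  have Ei: "integrable nu (indicator E :: 'a \<Rightarrow> real)" using E by simp
  have uL: "u \<in> L2 nu"
  proof (rule L2_bound[OF L2_cmult[OF EL, of k] um])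
    show "\<bar>u x\<bar> \<le> \<bar>k * indicator E x\<bar>" for x using u(2)[of x] E(3)[of x] k by (cases "x \<in> E") auto
  qed
  have du: "integrable M (dens u)"
    by (rule dens_integrable_of_powr[OF um integrable_powr_bounded[OF uL u(2)]])
  have grad_bd: "\<bar>grad u x y\<bar> \<le> 2 * k * (indicator E x + indicator E y)" for x y
    using u(2)[of x] u(2)[of y] E(3)[of x] E(3)[of y] k by (auto simp: grad_def indicator_def)
  have tu: "integrable M (tv u)"
  proof (rule Bochner_Integration.integrable_bound)
    show "integrable M (\<lambda>z. 2 * k * (indicator E (fst z) + indicator E (snd z)))"
      using integrable_nu_m_fst[OF Ei] integrable_nu_m_snd[OF Ei] by simp
    have "tv u z \<le> \<bar>grad u (fst z) (snd z)\<bar>" for z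
    proof -
      have "\<bar>grad u (fst z) (snd z)\<bar> * (Kker A (fst z) (snd z) / 2) \<le> \<bar>grad u (fst z) (snd z)\<bar> * 1"
        using Kker_le_1[of A "fst z" "snd z"] by (intro mult_left_mono) auto
      then show ?thesis by (simp add: tv_def)
    qed
    then have "tv u z \<le> 2 * k * (indicator E (fst z) + indicator E (snd z))" for z
      using grad_bd by (rule order_trans)
    then show "AE z in M. norm (tv u z) \<le> norm (2 * k * (indicator E (fst z) + indicator E (snd z)))"
      using k by (intro AE_I2) (simp add: tv_nonneg abs_of_nonneg)
  qed measurable
  define G where "G z = Kker A (fst z) (snd z) * sgn (grad u (fst z) (snd z)) + flux u z" for z
  have Gm[measurable]: "G \<in> borel_measurable (nu \<Otimes>\<^sub>M nu)" unfolding G_def[abs_def] by measurable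
  have Ganti: "G (y, x) = - G (x, y)" for x y
    using flux_antisym[of u y x] by (simp add: G_def Kker_commute[of A y x] grad_commute[of u y x] sgn_minus)
  \<comment> \<open>The 1 bounds the sign part, and \<open>(2 * k) powr (p - 1)\<close> bounds the
    flux because gradients are at most \<open>2 * k\<close> in modulus.\<close>
  define C where "C = 1 + (2 * k) powr (p - 1)"
  have C: "C \<ge> 0" by (simp add: C_def)
  have Gbd: "\<bar>G z\<bar> \<le> C * (indicator E (fst z) + indicator E (snd z))" for z
  proof (cases "fst z \<in> E \<or> snd z \<in> E")
    case True
    have "\<bar>grad u (fst z) (snd z)\<bar> \<le> 2 * k" using u(2)[of "fst z"] u(2)[of "snd z"] by (simp add: grad_def)
    then have g: "\<bar>grad u (fst z) (snd z)\<bar> powr (p - 1) \<le> (2 * k) powr (p - 1)" using p by (intro powr_mono2) auto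
    have "\<bar>G z\<bar> \<le> \<bar>Kker A (fst z) (snd z) * sgn (grad u (fst z) (snd z))\<bar> + \<bar>flux u z\<bar>"
      unfolding G_def by (rule abs_triangle_ineq)
    also have "\<dots> \<le> 1 * 1 + 1 * (2 * k) powr (p - 1)"
      unfolding flux_def abs_mult abs_signed_pow
      by (intro add_mono mult_mono g) (auto simp: abs_of_nonneg Kker_nonneg Kker_le_1 abs_sgn_eq)
    also have "\<dots> = C * 1" by (simp add: C_def)
    also have "\<dots> \<le> C * (indicator E (fst z) + indicator E (snd z))"
      using True by (intro mult_left_mono C) (auto simp: indicator_def)
    finally show ?thesis .
  next
    case False
    then have "grad u (fst z) (snd z) = 0" using E(3) by (simp add: grad_def)
    then show ?thesis using C by (simp add: G_def flux_def)
  qed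
  have "(\<lambda>z. C * (indicator E (fst z) + indicator E (snd z))) \<in> L2 M"
    by (rule L2_cmult[OF L2_add[OF L2_nu_m_fst[OF EL] L2_nu_m_snd[OF EL]]])
  then have GL: "G \<in> L2 M"
  proof (rule L2_bound)
    show "\<bar>G z\<bar> \<le> \<bar>C * (indicator E (fst z) + indicator E (snd z))\<bar>" for z
      using Gbd[of z] by linarith
  qed measurable
  define V where "V x = (\<integral>y. G (x, y) \<partial>(m x))" for x
  have VL: "V \<in> L2 nu" unfolding V_def[abs_def] by (rule L2_kernel_integral[OF Gm L2_integrable[OF GL]])
  have fin: "F_1 nu m A u < \<infinity>" "F_p nu m B p u < \<infinity>"
    using F_1_finite_iff[OF um] F_p_finite_iff[OF um] tu du by auto
  have "enn2real (F_1 nu m A u + F_p nu m B p u) + (\<integral>x. - V x * (w x - u x) \<partial>nu) \<le> enn2real (F_1 nu m A w + F_p nu m B p w)"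
    if w: "w \<in> L2 nu" "F_1 nu m A w + F_p nu m B p w < \<infinity>" for w
  proof -
    have wm[measurable]: "w \<in> borel_measurable nu" by (rule L2_measurable[OF w(1)])
    have finw: "F_1 nu m A w < \<infinity>" "F_p nu m B p w < \<infinity>" using w(2) by auto
    have tw: "integrable M (tv w)" using finw F_1_finite_iff[OF wm] by simp
    have dw: "integrable M (dens w)" using finw F_p_finite_iff[OF wm] by simp
    define f where "f x = w x - u x" for x
    have fL: "f \<in> L2 nu" unfolding f_def by (intro L2_diff w uL)
    have fm: "f \<in> borel_measurable nu" by (rule L2_measurable[OF fL])
    have i: "integrable M (\<lambda>z. G z * f (fst z))" by (rule L2_mult_integrable[OF GL L2_nu_m_fst[OF fL]])
    note pt = parts_integrable[OF Gm Ganti i fm] parts[OF Gm Ganti i fm]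
    have "(\<integral>z. (tv u z + dens u z / (2 * p)) + G z * grad f (fst z) (snd z) / 2 \<partial>M) \<le> (\<integral>z. tv w z + dens w z / (2 * p) \<partial>M)"
    proof (rule integral_mono)
      show "integrable M (\<lambda>z. (tv u z + dens u z / (2 * p)) + G z * grad f (fst z) (snd z) / 2)"
        using tu du pt(1) by simp
      show "integrable M (\<lambda>z. tv w z + dens w z / (2 * p))" using tw dw by simp
      fix z
      have gf: "grad f (fst z) (snd z) = grad w (fst z) (snd z) - grad u (fst z) (snd z)"
        by (simp add: grad_def f_def)
      have "tv u z + Kker A (fst z) (snd z) * sgn (grad u (fst z) (snd z)) * grad f (fst z) (snd z) / 2 \<le> tv w z"
        using mult_left_mono[OF abs_subgradient[of "grad u (fst z) (snd z)" "grad w (fst z) (snd z)"],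
            of "Kker A (fst z) (snd z) / 2"] Kker_nonneg[of A "fst z" "snd z"]
        unfolding gf by (simp add: tv_def algebra_simps diff_divide_distrib add_divide_distrib)
      moreover have "dens u z / (2 * p) + flux u z * grad f (fst z) (snd z) / 2 \<le> dens w z / (2 * p)"
        unfolding gf by (rule dens_subgradient)
      ultimately show "tv u z + dens u z / (2 * p) + G z * grad f (fst z) (snd z) / 2 \<le> tv w z + dens w z / (2 * p)"
        unfolding G_def distrib_right add_divide_distrib by linarith
    qed
    also have "(\<integral>z. (tv u z + dens u z / (2 * p)) + G z * grad f (fst z) (snd z) / 2 \<partial>M)
        = (\<integral>z. tv u z \<partial>M) + (\<integral>z. dens u z / (2 * p) \<partial>M) - (\<integral>x. V x * f x \<partial>nu)"
      using tu du pt by (simp add: V_def)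
    also have "(\<integral>z. tv w z + dens w z / (2 * p) \<partial>M) = (\<integral>z. tv w z \<partial>M) + (\<integral>z. dens w z / (2 * p) \<partial>M)"
      using tw dw by simp
    finally show ?thesis
      using fin finw
      by (simp add: enn2real_plus F_1_eq[OF um tu] F_1_eq[OF wm tw] F_p_eq[OF um du] F_p_eq[OF wm dw] f_def)
  qed
  moreover have "F_1 nu m A u + F_p nu m B p u < \<infinity>" using fin by simp
  ultimately have "(u, \<lambda>x. - V x) \<in> subdiff nu (\<lambda>u. F_1 nu m A u + F_p nu m B p u)"
    unfolding subdiff_iff using uL L2_uminus[OF VL] by blast
  then show "u \<in> op_dom (subdiff nu (\<lambda>u. F_1 nu m A u + F_p nu m B p u))"
    unfolding op_dom_def by (rule rev_image_eqI) simp
qed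

lemma dense_domain_sum:
  "dense_L2 nu (op_dom (subdiff nu (\<lambda>u. F_1 nu m A u + F_p nu m B p u)))"
  unfolding dense_L2_def
proof (intro conjI ballI allI impI)
  show "op_dom (subdiff nu (\<lambda>u. F_1 nu m A u + F_p nu m B p u)) \<subseteq> L2 nu"
    by (auto simp: op_dom_def subdiff_def)
  fix w :: "'a \<Rightarrow> real" and e :: real
  assume w: "w \<in> L2 nu" and e: "e > 0"
  define E where "E n = {x \<in> space nu. 1 / real (Suc n) \<le> \<bar>w x\<bar> \<and> \<bar>w x\<bar> \<le> real (Suc n)}" for n
  note E = L2_truncate[OF w, folded E_def]
  obtain n where n: "(\<integral>x. (w x - w x * indicator (E n) x)\<^sup>2 \<partial>nu) < e"
    using order_tendstoD(2)[OF E(3) e] by (auto simp: eventually_sequentially)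
  have [measurable]: "w \<in> borel_measurable nu" "E n \<in> sets nu" using E(1) L2_measurable[OF w] by auto
  have "(\<lambda>x. w x * indicator (E n) x) \<in> op_dom (subdiff nu (\<lambda>u. F_1 nu m A u + F_p nu m B p u))"
    by (rule bounded_finite_support_in_domain[OF _ _ E(1,2), of _ "real (Suc n)"])
       (auto simp: E_def indicator_def simp del: of_nat_Suc)
  then show "\<exists>u\<in>op_dom (subdiff nu (\<lambda>u. F_1 nu m A u + F_p nu m B p u)). (\<integral>x. (w x - u x)\<^sup>2 \<partial>nu) < e"
    using n by (intro bexI[of _ "\<lambda>x. w x * indicator (E n) x"])
qed

end

theorem theorem4p3:
  fixes nu :: "'a measure" and m :: "'a \<Rightarrow> 'a measure"
    and A B :: "'a \<Rightarrow> 'a set" and p :: real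
  assumes rws: "random_walk_space nu m"
    and rev: "reversible nu m"
    and p: "p > 1"
    and A_meas: "{(x, y). x \<in> space nu \<and> y \<in> A x} \<in> sets (nu \<Otimes>\<^sub>M nu)"
    and B_meas: "{(x, y). x \<in> space nu \<and> y \<in> B x} \<in> sets (nu \<Otimes>\<^sub>M nu)"
    and A_sets: "\<forall>x\<in>space nu. A x \<in> sets nu \<and> emeasure (m x) (A x) > 0"
    and B_sets: "\<forall>x\<in>space nu. B x \<in> sets nu \<and> emeasure (m x) (B x) > 0"
    and AB_supp: "\<forall>x\<in>space nu. emeasure (m x) (space nu - (A x \<union> B x)) = 0"
    and cases: "emeasure nu (space nu) < \<infinity> \<or> (emeasure nu (space nu) = \<infinity> \<and> p \<ge> 2)"
  shows "subdiff nu (\<lambda>u. F_1 nu m A u + F_p nu m B p u)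
           = op_sum (subdiff nu (F_1 nu m A)) (subdiff nu (F_p nu m B p))
       \<and> op_sum (subdiff nu (F_1 nu m A)) (subdiff nu (F_p nu m B p))
           = op_sum (op_neg (Delta_1 nu m A)) (op_neg (Delta_p nu m B p))
       \<and> completely_accretive nu (subdiff nu (\<lambda>u. F_1 nu m A u + F_p nu m B p u))
       \<and> dense_L2 nu (op_dom (subdiff nu (\<lambda>u. F_1 nu m A u + F_p nu m B p u)))"
proof -
  interpret energy_walk nu m B p A
  proof (intro energy_walk.intro p_laplace_walk.intro reversible_walk.intro
      p_laplace_walk_axioms.intro energy_walk_axioms.intro)
    show "emeasure nu (space nu) < \<infinity> \<or> p \<ge> 2" using cases by auto
  qed (fact rws rev p A_meas B_meas)+
  show ?thesis
    using subdiff_sum op_neg_Delta_1[of nu m A] op_neg_Delta_p completely_accretive_sum dense_domain_sum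
    by simp
qed

end
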